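(* Let $s\in L_{2,loc}(\mathbb{R}_+)$ be complex-valued and let $L_0$ be the minimal operator constructed from $s$. If $L_0$ has extensions with compact resolvents, then $$\forall a>0\quad \lim_{x\to+\infty}\int_x^{x+a}\int_x^{x+a}|s(\xi)-s(\eta)|^2\,d\xi\,d\eta=+\infty .$$
   Context: $\mathbb{R}_+=[0,+\infty)$; the subscript "loc" means the property holds on every segment $[0,R]$. Minimal operator constructed from a complex-valued $s\in L_{2,loc}(\mathbb{R}_+)$: for $y\in AC_{loc}(\mathbb{R}_+)$ put $y^{[1]}=y'-sy$, and if $y^{[1]}\in AC_{loc}(\mathbb{R}_+)$ put $l(y)=-(y^{[1]})'-sy^{[1]}-s^2y$ (a regularization of $-y''+s'y$, where $s'$ is the distributional derivative). Let $$\mathscr{D}_0=\{y\in L_2(\mathbb{R}_+): y,y^{[1]}\in AC_{loc}(\mathbb{R}_+),\ l(y)\in L_2(\mathbb{R}_+),\ y(0)=y^{[1]}(0)=0,\ \operatorname{supp}y\text{ compact}\}.$$ The minimal operator $L_0$ acts in $L_2(\mathbb{R}_+)$ by $L_0y=l(y)$ on the domain $\mathscr{D}_0$. "$L_0$ has extensions with compact resolvents" means that there is a linear operator $L$ in $L_2(\mathbb{R}_+)$ extending $L_0$ with non-empty resolvent set and with $(L-\lambda)^{-1}$ compact for $\lambda$ in the resolvent set. *)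

theory Defs
  imports "HOL-Analysis.Analysis"
begin

definition square_integrable :: "real set \<Rightarrow> (real \<Rightarrow> complex) set" where
  "square_integrable S = {f \<in> borel_measurable (lebesgue_on S).
     integrable (lebesgue_on S) (\<lambda>x. (cmod (f x))\<^sup>2)}"

definition square_integrable_loc :: "(real \<Rightarrow> complex) set" where
  "square_integrable_loc = {f. \<forall>R>0. f \<in> square_integrable {0..R}}"

text \<open>
  The finite set \<open>D\<close> consists of compact intervals with pairwise disjoint interiors, and
  the interval \<open>k\<close> is \<open>{Inf k..Sup k}\<close>.
\<close>
definition absolutely_continuous_on :: "real set \<Rightarrow> (real \<Rightarrow> complex) \<Rightarrow> bool" where
  "absolutely_continuous_on S f \<longleftrightarrow>
     (\<forall>\<epsilon>>0. \<exists>\<delta>>0. \<forall>D. D division_of \<Union>D \<and> \<Union>D \<subseteq> S \<and> (\<Sum>k\<in>D. Sup k - Inf k) < \<delta> \<longrightarrow>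
        (\<Sum>k\<in>D. cmod (f (Sup k) - f (Inf k))) < \<epsilon>)"

definition AC_loc :: "(real \<Rightarrow> complex) \<Rightarrow> bool" where
  "AC_loc f \<longleftrightarrow> (\<forall>R>0. absolutely_continuous_on {0..R} f)"


subsection \<open>Operators in \<open>L\<^sub>2\<close> of the half-line\<close>

text \<open>
  An element of \<open>L\<^sub>2\<close> is represented by any of the functions in its class, so that functions
  are compared with \<open>L2_eq\<close>. An operator is given by its graph, a set of pairs of functions
  that is closed under \<open>L2_eq\<close> in both components. Values of functions at negative arguments
  play no role.
\<close>

abbreviation L2 :: "(real \<Rightarrow> complex) set" where
  "L2 \<equiv> square_integrable {0..}"

definition L2_eq :: "(real \<Rightarrow> complex) \<Rightarrow> (real \<Rightarrow> complex) \<Rightarrow> bool" where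
  "L2_eq f g \<longleftrightarrow> (AE x in lebesgue_on {0..}. f x = g x)"

definition L2_norm :: "(real \<Rightarrow> complex) \<Rightarrow> real" where
  "L2_norm f = sqrt (LINT x|lebesgue_on {0..}. (cmod (f x))\<^sup>2)"

type_synonym graph = "((real \<Rightarrow> complex) \<times> (real \<Rightarrow> complex)) set"

definition linear_operator :: "graph \<Rightarrow> bool" where
  "linear_operator T \<longleftrightarrow>
     T \<subseteq> L2 \<times> L2 \<and>
     (\<forall>f g f' g'. (f, g) \<in> T \<and> f' \<in> L2 \<and> g' \<in> L2 \<and> L2_eq f f' \<and> L2_eq g g' \<longrightarrow> (f', g') \<in> T) \<and>
     (\<forall>f g h. (f, g) \<in> T \<and> (f, h) \<in> T \<longrightarrow> L2_eq g h) \<and>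
     (\<lambda>x. 0, \<lambda>x. 0) \<in> T \<and>
     (\<forall>f g f' g'. (f, g) \<in> T \<and> (f', g') \<in> T \<longrightarrow> (\<lambda>x. f x + f' x, \<lambda>x. g x + g' x) \<in> T) \<and>
     (\<forall>c f g. (f, g) \<in> T \<longrightarrow> (\<lambda>x. c * f x, \<lambda>x. c * g x) \<in> T)"

definition bounded_everywhere_operator :: "graph \<Rightarrow> bool" where
  "bounded_everywhere_operator T \<longleftrightarrow>
     linear_operator T \<and> (\<forall>f\<in>L2. \<exists>g. (f, g) \<in> T) \<and>
     (\<exists>C. \<forall>(f, g)\<in>T. L2_norm g \<le> C * L2_norm f)"

definition compact_operator :: "graph \<Rightarrow> bool" where
  "compact_operator T \<longleftrightarrow>
     bounded_everywhere_operator T \<and>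
     (\<forall>f g C. (\<forall>n::nat. (f n, g n) \<in> T \<and> L2_norm (f n) \<le> C) \<longrightarrow>
        (\<exists>h\<in>L2. \<exists>r. strict_mono (r :: nat \<Rightarrow> nat) \<and>
           (\<lambda>n. L2_norm (\<lambda>x. g (r n) x - h x)) \<longlonglongrightarrow> 0))"

text \<open>The graph of \<open>(T - z)\<close> with its components exchanged, that is, of \<open>(T - z)\<close> inverse.\<close>
definition resolvent :: "graph \<Rightarrow> complex \<Rightarrow> graph" where
  "resolvent T z = {(\<lambda>x. g x - z * f x, f) | f g. (f, g) \<in> T}"

text \<open>
  Single-valuedness of \<open>resolvent T z\<close> is injectivity of \<open>T - z\<close>, and that its domain is
  \<open>L\<^sub>2\<close> is surjectivity of \<open>T - z\<close>.
\<close>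
definition resolvent_set :: "graph \<Rightarrow> complex set" where
  "resolvent_set T = {z. bounded_everywhere_operator (resolvent T z)}"


subsection \<open>The minimal operator\<close>

text \<open>
  \<open>u\<close> is the locally absolutely continuous representative of \<open>y' - s y\<close>, which is defined
  only almost everywhere. It is unique on the half-line, and its existence says that
  \<open>y' - s y\<close> is locally absolutely continuous.
\<close>
definition quasi_derivative ::
  "(real \<Rightarrow> complex) \<Rightarrow> (real \<Rightarrow> complex) \<Rightarrow> (real \<Rightarrow> complex) \<Rightarrow> bool" where
  "quasi_derivative s y u \<longleftrightarrow> AC_loc u \<and>
     (AE x in lebesgue_on {0..}. u x = vector_derivative y (at x) - s x * y x)"

text \<open>The expression \<open>l(y)\<close>, where \<open>u\<close> is the quasi-derivative of \<open>y\<close>.\<close>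
definition l_expr ::
  "(real \<Rightarrow> complex) \<Rightarrow> (real \<Rightarrow> complex) \<Rightarrow> (real \<Rightarrow> complex) \<Rightarrow> real \<Rightarrow> complex" where
  "l_expr s y u = (\<lambda>x. - vector_derivative u (at x) - s x * u x - (s x)\<^sup>2 * y x)"

text \<open>
  The two \<open>L2_eq\<close> conjuncts let \<open>(f, g)\<close> range over all representatives of the pair
  consisting of \<open>y\<close> and \<open>l(y)\<close>.
\<close>
definition minimal_operator :: "(real \<Rightarrow> complex) \<Rightarrow> graph" where
  "minimal_operator s = {(f, g) \<in> L2 \<times> L2. \<exists>y u.
     L2_eq f y \<and> L2_eq g (l_expr s y u) \<and>
     y \<in> L2 \<and> AC_loc y \<and> quasi_derivative s y u \<and> l_expr s y u \<in> L2 \<and>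
     y 0 = 0 \<and> u 0 = 0 \<and> compact (closure {x. 0 \<le> x \<and> y x \<noteq> 0})}"

definition has_extension_with_compact_resolvent :: "graph \<Rightarrow> bool" where
  "has_extension_with_compact_resolvent T \<longleftrightarrow>
     (\<exists>L. linear_operator L \<and> T \<subseteq> L \<and> resolvent_set L \<noteq> {} \<and>
        (\<forall>z\<in>resolvent_set L. compact_operator (resolvent L z)))"

end

theory Submission
  imports Defs
begin

text \<open>
  Suppose that the double integral does not tend to infinity. Then it stays below some \<open>K\<close> on
  pairwise disjoint intervals \<open>I\<^sub>n = {x\<^sub>n..x\<^sub>n + a}\<close>. Since it is the mean over \<open>\<eta>\<close> of \<open>a\<close> times
  the integral of \<open>|s - s(\<eta>)|\<^sup>2\<close>, some value \<open>c\<^sub>n\<close> of \<open>s\<close> on \<open>I\<^sub>n\<close> satisfies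
  \<open>\<integral> |s - c\<^sub>n|\<^sup>2 \<le> K/a\<close> over \<open>I\<^sub>n\<close>. Formally \<open>l(y) = -y'' + s'y\<close>, so subtracting the constant
  \<open>c\<^sub>n\<close> from \<open>s\<close> alters the quasi-derivative but not \<open>l(y)\<close>, and on \<open>I\<^sub>n\<close> the operator is
  that of \<open>\<sigma> = s - c\<^sub>n\<close>, whose \<open>L\<^sub>2\<close> norm is bounded uniformly in \<open>n\<close>. This yields
  functions \<open>y\<^sub>n\<close> in the domain of \<open>L\<^sub>0\<close>, supported in \<open>I\<^sub>n\<close>, with \<open>\<parallel>y\<^sub>n\<parallel>\<close> and
  \<open>\<parallel>l(y\<^sub>n)\<parallel>\<close> bounded above and \<open>\<parallel>y\<^sub>n\<parallel>\<close> bounded away from zero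
  (\<open>test_function_of_bounded_oscillation\<close>). If \<open>L\<close> extends \<open>L\<^sub>0\<close> and \<open>(L - z)\<close> has a compact
  inverse, then this inverse maps the bounded sequence \<open>l(y\<^sub>n) - z y\<^sub>n\<close> to \<open>y\<^sub>n\<close>, so a subsequence
  of \<open>y\<^sub>n\<close> converges, although the disjoint supports keep its terms apart
  (\<open>no_separated_bounded_sequence\<close>).

  The functions \<open>y\<^sub>n\<close> are built as follows. By the pigeonhole principle \<open>I\<^sub>n\<close> has a subinterval
  \<open>J\<close>, of length independent of \<open>n\<close>, on which the integral of \<open>|\<sigma>|\<^sup>2 + 1\<close> is at most
  \<open>1/8\<close>. With the ansatz \<open>w' = q w\<close>, \<open>q = \<sigma> + r\<close>, the equation \<open>l(w) = 0\<close> becomes the Riccati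
  equation \<open>r' = -q\<^sup>2\<close>, and the smallness on \<open>J\<close> makes the corresponding integral operator a contraction
  (\<open>riccati_solution\<close>). The solution \<open>w\<close> is an exponential, hence \<open>1/2 \<le> |w| \<le> 2\<close>
  (\<open>zero_energy_solution\<close>). Multiplying \<open>w\<close> by the square of the bump
  \<open>\<phi>(x) = (x - \<alpha>)(\<beta> - x)\<close> on \<open>J = {\<alpha>..\<beta>}\<close> gives \<open>y = \<phi>\<^sup>2 w\<close>: all singular terms cancel, and
  \<open>l(y) = -w (2\<tau>\<^sup>2 - 4\<phi> + 4\<phi>\<tau>q)\<close> with \<open>\<tau> = \<phi>'\<close>, which is bounded in \<open>L\<^sub>2\<close> by the norm of \<open>\<sigma>\<close>
  (\<open>test_function_on_short_interval\<close>).

  The derivatives in the definition of \<open>L\<^sub>0\<close> are pointwise ones, taken almost everywhere. The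
  regularity of \<open>y\<close> therefore rests on two facts about indefinite integrals of integrable
  functions: they are absolutely continuous, and they are differentiable almost everywhere with
  the integrand as derivative.
\<close>

section \<open>Differentiation of indefinite integrals\<close>

lemma integral_atMost_diff:
  fixes g :: "real \<Rightarrow> 'a::euclidean_space"
  assumes g: "g absolutely_integrable_on UNIV" and ab: "a \<le> b"
  shows "integral {..b} g - integral {..a} g = integral {a..b} g"
proof -
  have i: "g integrable_on {..b}" "g integrable_on {..a}" "g integrable_on {a..b}"
    using g by (auto intro!: set_lebesgue_integral_eq_integral(1) set_integrable_subset[OF g])
  have "integral ({..a} \<union> {a..b}) g = integral {..a} g + integral {a..b} g"
  proof (rule integral_Un)
    have "{..a} \<inter> {a..b} \<subseteq> {a}" by auto
    then show "negligible ({..a} \<inter> {a..b})"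
      using negligible_subset negligible_sing by blast
  qed (use i in auto)
  moreover have "{..a} \<union> {a..b} = {..b}" using ab by auto
  ultimately show ?thesis by simp
qed

text \<open>
  A point \<open>x\<close> of this set is an end point of arbitrarily short segments over which the integral of
  \<open>g\<close> differs from length times \<open>g x\<close> by more than \<open>\<epsilon>\<close> times the length. The covering theorem
  of Vitali selects disjoint ones that still cover the set up to measure zero. Tagged with these
  end points they form a partial division, and the lemma of Henstock makes the sum of the
  differences, hence the total length, as small as desired.
\<close>
lemma negligible_failure_of_derivative:
  fixes g :: "real \<Rightarrow> 'a::euclidean_space"
  assumes g: "g absolutely_integrable_on UNIV" and "\<epsilon> > 0"
  defines "F \<equiv> \<lambda>x. integral {..x} g"
  shows "negligible {x \<in> {a<..<b}. \<forall>\<delta>>0. \<exists>y. \<bar>y - x\<bar> < \<delta> \<and>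
           norm (F y - F x - (y - x) *\<^sub>R g x) > \<epsilon> * \<bar>y - x\<bar>}" (is "negligible ?E")
proof -
  have "\<exists>T. ?E \<subseteq> T \<and> T \<in> lmeasurable \<and> measure lebesgue T \<le> e" if "e > 0" for e
  proof -
    have "g integrable_on cbox a b"
      by (auto intro!: set_lebesgue_integral_eq_integral(1) set_integrable_subset[OF g])
    moreover have "\<epsilon> * e > 0" using assms that by auto
    ultimately obtain \<gamma> where "gauge \<gamma>"
      and \<gamma>: "\<And>p. \<lbrakk>p tagged_partial_division_of (cbox a b); \<gamma> fine p\<rbrakk> \<Longrightarrow>
             sum (\<lambda>(x,k). norm(measure lborel k *\<^sub>R g x - integral k g)) p < \<epsilon> * e"
      by (rule Henstock_lemma) blast
    \<comment> \<open>the segments of the Vitali covering, each given by its tag \<open>x\<close> and its other end \<open>y\<close>\<close>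
    define bad where "bad = (\<lambda>x y. norm (F y - F x - (y - x) *\<^sub>R g x) > \<epsilon> * \<bar>y - x\<bar>)"
    define K where "K = {(x,y). x \<in> ?E \<and> y \<in> {a<..<b} \<and> closed_segment x y \<subseteq> \<gamma> x \<and> bad x y}"
    define m where "m = (\<lambda>(x::real,y). (x + y) / 2)"
    define \<rho> where "\<rho> = (\<lambda>(x::real,y). \<bar>y - x\<bar> / 2)"
    have seg: "cball (m (x,y)) (\<rho> (x,y)) = {min x y..max x y}" for x y
      by (auto simp: m_def \<rho>_def cball_eq_atLeastAtMost min_def max_def field_simps)
    have cseg: "closed_segment x y = {min x y..max x y}" for x y :: real
      by (simp add: closed_segment_eq_real_ivl min_def max_def)
    have ne: "x \<noteq> y" if "(x,y) \<in> K" for x y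
      using that by (auto simp: K_def bad_def)
    have pos: "0 < \<rho> i" if "i \<in> K" for i
      using ne that by (cases i) (auto simp: \<rho>_def)
    have cover: "\<exists>i. i \<in> K \<and> x \<in> cball (m i) (\<rho> i) \<and> \<rho> i < d" if x: "x \<in> ?E" and "0 < d" for x d
    proof -
      have "open (\<gamma> x)" "x \<in> \<gamma> x" using \<open>gauge \<gamma>\<close> by (auto simp: gauge_def)
      then obtain d1 where d1: "d1 > 0" "ball x d1 \<subseteq> \<gamma> x" by (meson open_contains_ball)
      have "open {a<..<b}" "x \<in> {a<..<b}" using x by auto
      then obtain d2 where d2: "d2 > 0" "ball x d2 \<subseteq> {a<..<b}" by (meson open_contains_ball)
      have "min d (min d1 d2) > 0" using d1 d2 \<open>d > 0\<close> by auto
      then obtain y where y: "\<bar>y - x\<bar> < min d (min d1 d2)" "bad x y"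
        using x unfolding bad_def by blast
      have "closed_segment x y \<subseteq> ball x d1"
        using y(1) d1 by (intro closed_segment_subset) (auto simp: dist_real_def)
      moreover have "y \<in> ball x d2" using y by (auto simp: dist_real_def)
      ultimately have "(x,y) \<in> K" using x y d1 d2 unfolding K_def by blast
      moreover have "x \<in> cball (m (x,y)) (\<rho> (x,y))" unfolding seg by auto
      moreover have "\<rho> (x,y) < d" using y by (auto simp: \<rho>_def)
      ultimately show ?thesis by blast
    qed
    obtain C where C: "countable C" "C \<subseteq> K"
      "pairwise (\<lambda>i j. disjnt (cball (m i) (\<rho> i)) (cball (m j) (\<rho> j))) C"
      "negligible (?E - (\<Union>i \<in> C. cball (m i) (\<rho> i)))"
      using Vitali_covering_theorem_cballs[of K \<rho> ?E m, OF pos cover] by blast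
    have fin: "measure lebesgue (\<Union>i\<in>D. cball (m i) (\<rho> i)) \<le> e" if D: "D \<subseteq> C" "finite D" for D
    proof -
      define I where "I = (\<lambda>i. cball (m i) (\<rho> i))"
      have Iinj: "i = j" if "i \<in> D" "j \<in> D" "I i \<inter> I j \<noteq> {}" for i j
        using C(3) that D unfolding pairwise_def disjnt_def I_def by blast
      have Ine: "m i \<in> I i" if "i \<in> D" for i
        using pos[of i] that D C by (auto simp: I_def)
      have inj: "inj_on (\<lambda>i. (fst i, I i)) D"
        by (rule inj_onI) (metis Iinj Ine Int_iff empty_iff prod.inject)
      define p where "p = (\<lambda>i. (fst i, I i)) ` D"
      have I_ivl: "I i = {min (fst i) (snd i)..max (fst i) (snd i)}" for i
        using seg[of "fst i" "snd i"] by (simp add: I_def)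
      have p1: "p tagged_partial_division_of (cbox a b)"
        unfolding tagged_partial_division_of_def
      proof (intro conjI allI impI)
        show "finite p" using D by (simp add: p_def)
      next
        fix x k assume "(x,k) \<in> p"
        then obtain i where i: "i \<in> D" "x = fst i" "k = I i" by (auto simp: p_def)
        then have iK: "(fst i, snd i) \<in> K" using D C by auto
        show "x \<in> k" using i by (simp add: I_ivl)
        show "k \<subseteq> cbox a b" using iK i by (auto simp: I_ivl K_def)
        show "\<exists>a b. k = cbox a b" using i by (auto simp: I_ivl box_real)
      next
        fix x1 k1 x2 k2 assume *: "(x1,k1) \<in> p \<and> (x2,k2) \<in> p \<and> (x1,k1) \<noteq> (x2,k2)"
        then obtain i j where "i \<in> D" "j \<in> D" "i \<noteq> j" "k1 = I i" "k2 = I j" by (auto simp: p_def)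
        then have "k1 \<inter> k2 = {}" using Iinj by blast
        then show "interior k1 \<inter> interior k2 = {}" using interior_subset by blast
      qed
      have p2: "\<gamma> fine p"
      proof (rule fineI)
        fix x k assume "(x,k) \<in> p"
        then obtain i where i: "i \<in> D" "x = fst i" "k = I i" by (auto simp: p_def)
        then have iK: "(fst i, snd i) \<in> K" using D C by auto
        then show "k \<subseteq> \<gamma> x" using i unfolding K_def by (auto simp: I_ivl cseg)
      qed
      \<comment> \<open>the defining property of a bad segment, in a form that does not depend on the order of \<open>x\<close> and \<open>y\<close>\<close>
      have len: "\<epsilon> * measure lebesgue (I i) \<le> norm (measure lborel (I i) *\<^sub>R g (fst i) - integral (I i) g)"
        if "i \<in> D" for i
      proof -
        obtain x y where i: "i = (x,y)" by (cases i)
        have "(x,y) \<in> K" using that D C i by auto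
        then have bad: "bad x y" by (auto simp: K_def)
        show ?thesis
        proof (cases "x \<le> y")
          case True
          have "integral (I i) g = F y - F x"
            using True integral_atMost_diff[OF g True] by (simp add: I_ivl i F_def)
          moreover have "measure lborel (I i) = y - x" using True by (simp add: I_ivl i)
          ultimately show ?thesis using bad True unfolding bad_def
            by (simp add: i I_ivl norm_minus_commute)
        next
          case False
          then have yx: "y \<le> x" by simp
          have "integral (I i) g = F x - F y"
            using yx integral_atMost_diff[OF g yx] by (simp add: I_ivl i F_def)
          moreover have "measure lborel (I i) = x - y" using yx by (simp add: I_ivl i)
          moreover have "measure lebesgue (I i) = x - y" using yx by (simp add: I_ivl i)
          moreover have "\<epsilon> * (x - y) < norm ((x - y) *\<^sub>R g x - (F x - F y))"
          proof -
            have eq: "F y - F x - (y - x) *\<^sub>R g x = (x - y) *\<^sub>R g x - (F x - F y)"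
              by (simp add: algebra_simps)
            have "\<bar>y - x\<bar> = x - y" using yx by simp
            then show ?thesis using bad unfolding bad_def eq by simp
          qed
          ultimately show ?thesis by (simp add: i)
        qed
      qed
      have "\<epsilon> * measure lebesgue (\<Union>i\<in>D. I i) \<le> \<epsilon> * (\<Sum>i\<in>D. measure lebesgue (I i))"
        using assms D by (intro mult_left_mono measure_UNION_le) (auto simp: I_def)
      also have "\<dots> = (\<Sum>i\<in>D. \<epsilon> * measure lebesgue (I i))" by (simp add: sum_distrib_left)
      also have "\<dots> \<le> (\<Sum>i\<in>D. norm (measure lborel (I i) *\<^sub>R g (fst i) - integral (I i) g))"
        by (intro sum_mono len)
      also have "\<dots> = (\<Sum>(x,k)\<in>p. norm (measure lborel k *\<^sub>R g x - integral k g))"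
        unfolding p_def by (simp add: sum.reindex[OF inj])
      also have "\<dots> < \<epsilon> * e" by (rule \<gamma>[OF p1 p2])
      finally show ?thesis using assms by (simp add: I_def)
    qed
    let ?U = "\<Union>i\<in>C. cball (m i) (\<rho> i)"
    have U: "?U \<in> lmeasurable" "measure lebesgue ?U \<le> e"
      using fmeasurable_UN_bound[OF C(1), of "\<lambda>i. cball (m i) (\<rho> i)" lebesgue e]
        measure_UN_bound[OF C(1), of "\<lambda>i. cball (m i) (\<rho> i)" lebesgue e] fin by auto
    have "measure lebesgue (?U \<union> (?E - ?U)) \<le> measure lebesgue ?U + measure lebesgue (?E - ?U)"
      using U C(4) by (intro measure_Un_le) (auto dest: negligible_imp_sets)
    also have "\<dots> \<le> e" using U C(4) by (simp add: negligible_imp_measure0)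
    finally have "measure lebesgue (?U \<union> (?E - ?U)) \<le> e" .
    moreover have "?U \<union> (?E - ?U) \<in> lmeasurable"
      by (rule fmeasurable.Un[OF U(1) negligible_imp_measurable[OF C(4)]])
    ultimately show ?thesis by (intro exI[of _ "?U \<union> (?E - ?U)"]) simp
  qed
  then show ?thesis unfolding negligible_outer_le by blast
qed

text \<open>
  The differentiation theorem of Lebesgue. Failure of differentiability at a point is failure
  for some \<open>\<epsilon> = 1/(k + 1)\<close> on some bounded interval, which leaves countably many null sets.
\<close>
lemma AE_has_vector_derivative_integral_atMost:
  fixes g :: "real \<Rightarrow> 'a::euclidean_space"
  assumes g: "g absolutely_integrable_on UNIV"
  shows "AE x in lebesgue. ((\<lambda>x. integral {..x} g) has_vector_derivative g x) (at x)"
proof -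
  define F where "F = (\<lambda>x. integral {..x} g)"
  define E where "E = (\<lambda>n k. {x \<in> {-real n<..<real n}. \<forall>\<delta>>0. \<exists>y. \<bar>y - x\<bar> < \<delta> \<and>
           norm (F y - F x - (y - x) *\<^sub>R g x) > inverse (real (Suc k)) * \<bar>y - x\<bar>})"
  have "negligible (E n k)" for n k
    unfolding E_def F_def by (rule negligible_failure_of_derivative[OF g]) auto
  then have N: "(\<Union>n. \<Union>k. E n k) \<in> null_sets lebesgue"
    by (auto simp: negligible_iff_null_sets)
  have "(F has_vector_derivative g x) (at x)" if x: "x \<notin> (\<Union>n. \<Union>k. E n k)" for x
  proof -
    obtain n where n: "\<bar>x\<bar> < real n" using reals_Archimedean2 by blast
    have "\<exists>d>0. \<forall>y. norm (y - x) < d \<longrightarrow> norm (F y - F x - (y - x) *\<^sub>R g x) \<le> e * norm (y - x)"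
      if "e > 0" for e
    proof -
      obtain k where k: "inverse (real (Suc k)) < e" using reals_Archimedean \<open>e > 0\<close> by blast
      have "x \<notin> E n k" using x by blast
      then have "\<exists>\<delta>>0. \<forall>y. \<bar>y - x\<bar> < \<delta> \<longrightarrow>
          norm (F y - F x - (y - x) *\<^sub>R g x) \<le> inverse (real (Suc k)) * \<bar>y - x\<bar>"
        using n by (auto simp: E_def not_less simp del: of_nat_Suc) (metis not_less)
      then obtain \<delta> where "\<delta> > 0"
        "\<And>y. \<bar>y - x\<bar> < \<delta> \<Longrightarrow> norm (F y - F x - (y - x) *\<^sub>R g x) \<le> inverse (real (Suc k)) * \<bar>y - x\<bar>"
        by blast
      moreover have "inverse (real (Suc k)) * \<bar>y - x\<bar> \<le> e * \<bar>y - x\<bar>" for y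
        using k by (intro mult_right_mono) auto
      ultimately show ?thesis by (metis order_trans real_norm_def)
    qed
    then show ?thesis
      unfolding has_vector_derivative_def has_derivative_at_alt
      by (auto intro: bounded_linear_scaleR_left)
  qed
  then have "{x \<in> space lebesgue. \<not> (F has_vector_derivative g x) (at x)} \<subseteq> (\<Union>n. \<Union>k. E n k)"
    by blast
  then show ?thesis unfolding F_def by (rule AE_I'[OF N])
qed

section \<open>Locally absolutely continuous functions\<close>

text \<open>
  A weak inequality suffices, since \<open>\<epsilon>\<close> may be halved.
\<close>
lemma absolutely_continuous_onI:
  assumes "\<And>\<epsilon>. \<epsilon> > 0 \<Longrightarrow> \<exists>\<delta>>0. \<forall>D. D division_of \<Union>D \<and> \<Union>D \<subseteq> S \<and>
      (\<Sum>k\<in>D. Sup k - Inf k) < \<delta> \<longrightarrow> (\<Sum>k\<in>D. cmod (f (Sup k) - f (Inf k))) \<le> \<epsilon>"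
  shows "absolutely_continuous_on S f"
  unfolding absolutely_continuous_on_def
proof (intro allI impI)
  fix \<epsilon> :: real assume "\<epsilon> > 0"
  then obtain \<delta> where "\<delta> > 0" "\<forall>D. D division_of \<Union>D \<and> \<Union>D \<subseteq> S \<and>
      (\<Sum>k\<in>D. Sup k - Inf k) < \<delta> \<longrightarrow> (\<Sum>k\<in>D. cmod (f (Sup k) - f (Inf k))) \<le> \<epsilon> / 2"
    using assms[of "\<epsilon> / 2"] by auto
  moreover have "x \<le> \<epsilon> / 2 \<Longrightarrow> x < \<epsilon>" for x :: real using \<open>\<epsilon> > 0\<close> by auto
  ultimately show "\<exists>\<delta>>0. \<forall>D. D division_of \<Union>D \<and> \<Union>D \<subseteq> S \<and> (\<Sum>k\<in>D. Sup k - Inf k) < \<delta> \<longrightarrow>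
        (\<Sum>k\<in>D. cmod (f (Sup k) - f (Inf k))) < \<epsilon>" by blast
qed

lemma division_real_interval:
  fixes D :: "real set set"
  assumes "D division_of T" "k \<in> D"
  shows "k = {Inf k..Sup k}" "Inf k \<le> Sup k" "Inf k \<in> T" "Sup k \<in> T"
proof -
  obtain a b where k: "k = cbox a b" "k \<noteq> {}" "k \<subseteq> T"
    using assms by (metis cbox_division_memE)
  then have "a \<le> b" "Inf k = a" "Sup k = b" by auto
  with k show "k = {Inf k..Sup k}" "Inf k \<le> Sup k" "Inf k \<in> T" "Sup k \<in> T" by auto
qed

text \<open>
  The one closure property from which stability under sums, products and Lipschitz maps follows.
\<close>
lemma absolutely_continuous_on_dominated:
  assumes f: "absolutely_continuous_on S f" and g: "absolutely_continuous_on S g"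
    and C: "C \<ge> 0"
    and le: "\<And>x y. x \<in> S \<Longrightarrow> y \<in> S \<Longrightarrow> cmod (F x - F y) \<le> C * (cmod (f x - f y) + cmod (g x - g y))"
  shows "absolutely_continuous_on S F"
proof (rule absolutely_continuous_onI)
  fix \<epsilon> :: real assume "\<epsilon> > 0"
  define e where "e = \<epsilon> / (C + 1) / 2"
  have "2 * e * (C + 1) = \<epsilon>" using C by (simp add: e_def divide_simps)
  moreover have "e > 0" using \<open>\<epsilon> > 0\<close> C by (simp add: e_def)
  ultimately have e: "e > 0" "C * (e + e) \<le> \<epsilon>" by (auto simp: algebra_simps)
  obtain d1 where d1: "d1 > 0" "\<And>D. D division_of \<Union>D \<Longrightarrow> \<Union>D \<subseteq> S \<Longrightarrow> (\<Sum>k\<in>D. Sup k - Inf k) < d1 \<Longrightarrow>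
        (\<Sum>k\<in>D. cmod (f (Sup k) - f (Inf k))) < e"
    using f[unfolded absolutely_continuous_on_def, rule_format, OF e(1)] by blast
  obtain d2 where d2: "d2 > 0" "\<And>D. D division_of \<Union>D \<Longrightarrow> \<Union>D \<subseteq> S \<Longrightarrow> (\<Sum>k\<in>D. Sup k - Inf k) < d2 \<Longrightarrow>
        (\<Sum>k\<in>D. cmod (g (Sup k) - g (Inf k))) < e"
    using g[unfolded absolutely_continuous_on_def, rule_format, OF e(1)] by blast
  have "(\<Sum>k\<in>D. cmod (F (Sup k) - F (Inf k))) \<le> \<epsilon>"
    if D: "D division_of \<Union>D" "\<Union>D \<subseteq> S" "(\<Sum>k\<in>D. Sup k - Inf k) < min d1 d2" for D
  proof -
    have "(\<Sum>k\<in>D. cmod (F (Sup k) - F (Inf k)))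
      \<le> (\<Sum>k\<in>D. C * (cmod (f (Sup k) - f (Inf k)) + cmod (g (Sup k) - g (Inf k))))"
      by (intro sum_mono le; rule subsetD[OF D(2)]; erule division_real_interval(3,4)[OF D(1)])
    also have "\<dots> = C * ((\<Sum>k\<in>D. cmod (f (Sup k) - f (Inf k))) + (\<Sum>k\<in>D. cmod (g (Sup k) - g (Inf k))))"
      by (simp add: sum_distrib_left[symmetric] sum.distrib)
    also have "\<dots> \<le> C * (e + e)"
      using d1(2)[OF D(1,2)] d2(2)[OF D(1,2)] D(3) C by (intro mult_left_mono add_mono) auto
    finally show ?thesis using e by linarith
  qed
  then show "\<exists>\<delta>>0. \<forall>D. D division_of \<Union>D \<and> \<Union>D \<subseteq> S \<and>
      (\<Sum>k\<in>D. Sup k - Inf k) < \<delta> \<longrightarrow> (\<Sum>k\<in>D. cmod (F (Sup k) - F (Inf k))) \<le> \<epsilon>"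
    using d1(1) d2(1) by (intro exI[of _ "min d1 d2"]) auto
qed

lemma AC_loc_const: "AC_loc (\<lambda>x. c)"
  unfolding AC_loc_def absolutely_continuous_on_def by (auto intro: exI[of _ 1])

lemma AC_loc_of_real: "AC_loc complex_of_real"
  unfolding AC_loc_def
proof (intro allI impI absolutely_continuous_onI)
  fix R \<epsilon> :: real assume "\<epsilon> > 0"
  have "(\<Sum>k\<in>D. cmod (complex_of_real (Sup k) - of_real (Inf k))) = (\<Sum>k\<in>D. Sup k - Inf k)"
    if D: "D division_of \<Union>D" for D
    using division_real_interval(2)[OF D]
    by (intro sum.cong) (auto simp flip: of_real_diff)
  then show "\<exists>\<delta>>0. \<forall>D. D division_of \<Union>D \<and> \<Union>D \<subseteq> {0..R} \<and> (\<Sum>k\<in>D. Sup k - Inf k) < \<delta> \<longrightarrow>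
      (\<Sum>k\<in>D. cmod (complex_of_real (Sup k) - of_real (Inf k))) \<le> \<epsilon>"
    using \<open>\<epsilon> > 0\<close> by (intro exI[of _ \<epsilon>]) auto
qed

lemma AC_loc_add:
  assumes "AC_loc f" "AC_loc g"
  shows "AC_loc (\<lambda>x. f x + g x)"
  unfolding AC_loc_def
proof (intro allI impI)
  fix R :: real assume "R > 0"
  have "cmod ((f x + g x) - (f y + g y)) \<le> 1 * (cmod (f x - f y) + cmod (g x - g y))" for x y
    using norm_triangle_ineq[of "f x - f y" "g x - g y"] by (simp add: algebra_simps)
  then show "absolutely_continuous_on {0..R} (\<lambda>x. f x + g x)"
    by (rule absolutely_continuous_on_dominated[of _ f g 1, rotated 3])
      (use assms \<open>R > 0\<close> in \<open>auto simp: AC_loc_def\<close>)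
qed

text \<open>
  Continuity serves to bound both factors on each segment \<open>{0..R}\<close>.
\<close>
lemma AC_loc_mult:
  assumes "AC_loc f" "AC_loc g" "continuous_on UNIV f" "continuous_on UNIV g"
  shows "AC_loc (\<lambda>x. f x * g x)"
  unfolding AC_loc_def
proof (intro allI impI)
  fix R :: real assume "R > 0"
  have "bounded (f ` {0..R} \<union> g ` {0..R})"
    using assms by (auto intro!: compact_imp_bounded compact_continuous_image
        intro: continuous_on_subset)
  then obtain B where B: "\<And>x. x \<in> {0..R} \<Longrightarrow> cmod (f x) \<le> B" "\<And>x. x \<in> {0..R} \<Longrightarrow> cmod (g x) \<le> B"
    unfolding bounded_iff by (metis UnCI imageI)
  have "B \<ge> 0" using B(1)[of 0] \<open>R > 0\<close> norm_ge_zero[of "f 0"] by (auto simp del: norm_ge_zero)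
  have "cmod (f x * g x - f y * g y) \<le> B * (cmod (f x - f y) + cmod (g x - g y))"
    if "x \<in> {0..R}" "y \<in> {0..R}" for x y
  proof -
    have "f x * g x - f y * g y = (f x - f y) * g x + f y * (g x - g y)" by (simp add: algebra_simps)
    then have "cmod (f x * g x - f y * g y) \<le> cmod (f x - f y) * cmod (g x) + cmod (f y) * cmod (g x - g y)"
      by (metis norm_mult norm_triangle_ineq)
    also have "\<dots> \<le> cmod (f x - f y) * B + B * cmod (g x - g y)"
      using B that by (intro add_mono mult_mono mult_left_mono mult_right_mono) auto
    finally show ?thesis by (simp add: algebra_simps)
  qed
  then show "absolutely_continuous_on {0..R} (\<lambda>x. f x * g x)"
    by (rule absolutely_continuous_on_dominated[of _ f g B, rotated 3])
      (use assms \<open>R > 0\<close> \<open>B \<ge> 0\<close> in \<open>auto simp: AC_loc_def\<close>)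
qed

lemma AC_loc_lipschitz_comp:
  assumes f: "AC_loc f" and "C \<ge> 0"
    and le: "\<And>x y. cmod (\<phi> (f x) - \<phi> (f y)) \<le> C * cmod (f x - f y)"
  shows "AC_loc (\<lambda>x. \<phi> (f x))"
  unfolding AC_loc_def
proof (intro allI impI)
  fix R :: real assume "R > 0"
  have "cmod (\<phi> (f x) - \<phi> (f y)) \<le> C * (cmod (f x - f y) + cmod (f x - f y))" for x y
    using le[of x y] mult_left_mono[OF norm_ge_zero[of "f x - f y"] \<open>C \<ge> 0\<close>]
    by (simp add: algebra_simps)
  then show "absolutely_continuous_on {0..R} (\<lambda>x. \<phi> (f x))"
    by (rule absolutely_continuous_on_dominated[of _ f f C, rotated 3])
      (use f \<open>R > 0\<close> \<open>C \<ge> 0\<close> in \<open>auto simp: AC_loc_def\<close>)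
qed

lemma exp_lipschitz_on_cball:
  fixes z w :: complex
  assumes "cmod z \<le> M" "cmod w \<le> M"
  shows "cmod (exp z - exp w) \<le> exp M * cmod (z - w)"
proof (rule field_differentiable_bound[of "cball 0 M" exp exp])
  show "cmod (exp x) \<le> exp M" if "x \<in> cball 0 M" for x :: complex
    using that norm_exp[of x] by (force intro: order_trans)
  show "(exp has_field_derivative exp x) (at x within cball 0 M)" for x :: complex
    by (intro DERIV_subset[OF DERIV_exp]) auto
qed (use assms in auto)

text \<open>
  The part of an integrable function above a high level has small integral, by dominated
  convergence. Below that level the function is bounded, so its integral is controlled by the
  measure of the domain; this gives absolute continuity of the integral.
\<close>
lemma integral_tail_small:
  fixes G :: "real \<Rightarrow> real"
  assumes G: "G absolutely_integrable_on UNIV" "\<And>x. G x \<ge> 0" and "\<epsilon> > 0"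
  obtains M :: nat where "(\<lambda>x. max 0 (G x - M)) absolutely_integrable_on UNIV"
    "integral UNIV (\<lambda>x. max 0 (G x - M)) < \<epsilon>"
proof -
  have Gi: "integrable lebesgue G" using G(1) by (simp add: set_integrable_def)
  then have m[measurable]: "G \<in> borel_measurable lebesgue" by simp
  have i: "integrable lebesgue (\<lambda>x. max 0 (G x - real M))" for M :: nat
    by (rule Bochner_Integration.integrable_bound[OF Gi]) (use G(2) in \<open>auto simp: max_def\<close>)
  have "(\<lambda>M::nat. integral\<^sup>L lebesgue (\<lambda>x. max 0 (G x - real M))) \<longlonglongrightarrow> integral\<^sup>L lebesgue (\<lambda>x::real. 0::real)"
  proof (rule integral_dominated_convergence[where w=G])
    show "AE x in lebesgue. (\<lambda>M. max 0 (G x - real M)) \<longlonglongrightarrow> 0"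
    proof (rule AE_I2)
      fix x
      obtain N :: nat where N: "G x \<le> real N" using real_arch_simple by blast
      have "max 0 (G x - real M) = 0" if "M \<ge> N" for M
        using N that by (auto simp: max_def)
      then show "(\<lambda>M. max 0 (G x - real M)) \<longlonglongrightarrow> 0"
        by (intro tendsto_eventually) (auto simp: eventually_sequentially)
    qed
    show "AE x in lebesgue. norm (max 0 (G x - real M)) \<le> G x" for M
      using G(2) by (auto simp: max_def)
  qed (use Gi in auto)
  then have "eventually (\<lambda>M::nat. integral\<^sup>L lebesgue (\<lambda>x. max 0 (G x - real M)) < \<epsilon>) sequentially"
    using \<open>\<epsilon> > 0\<close> by (intro order_tendstoD(2)) auto
  then obtain M :: nat where M: "integral\<^sup>L lebesgue (\<lambda>x. max 0 (G x - real M)) < \<epsilon>"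
    by (auto simp: eventually_sequentially)
  have ai: "(\<lambda>x. max 0 (G x - real M)) absolutely_integrable_on UNIV"
    using i[of M] by (simp add: set_integrable_def)
  show ?thesis
    using that[OF ai] M set_lebesgue_integral_eq_integral(2)[OF ai]
    by (simp add: set_lebesgue_integral_def)
qed

lemma AC_loc_integral_atMost:
  assumes g: "g absolutely_integrable_on UNIV"
  shows "AC_loc (\<lambda>x. integral {..x} g)"
  unfolding AC_loc_def
proof (intro allI impI absolutely_continuous_onI)
  fix R \<epsilon> :: real assume "\<epsilon> > 0"
  have Ga: "(\<lambda>x. cmod (g x)) absolutely_integrable_on UNIV" using g by (rule absolutely_integrable_norm[unfolded o_def])
  obtain M :: nat where Ma: "(\<lambda>x. max 0 (cmod (g x) - M)) absolutely_integrable_on UNIV"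
    and M: "integral UNIV (\<lambda>x. max 0 (cmod (g x) - M)) < \<epsilon> / 2"
    using integral_tail_small[OF Ga norm_ge_zero, of "\<epsilon> / 2"] \<open>\<epsilon> > 0\<close> by auto
  define H where "H = (\<lambda>x. max 0 (cmod (g x) - M))"
  have Hi: "H integrable_on T" if "T \<in> sets lebesgue" for T
    using that by (auto intro!: set_lebesgue_integral_eq_integral(1) set_integrable_subset[OF Ma] simp: H_def)
  define \<delta> where "\<delta> = \<epsilon> / (2 * (real M + 1))"
  have \<delta>: "\<delta> > 0" "M * \<delta> \<le> \<epsilon> / 2" using \<open>\<epsilon> > 0\<close> by (auto simp: \<delta>_def field_simps)
  have "(\<Sum>k\<in>D. cmod (integral {..Sup k} g - integral {..Inf k} g)) \<le> \<epsilon>"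
    if D: "D division_of \<Union>D" "(\<Sum>k\<in>D. Sup k - Inf k) < \<delta>" for D
  proof -
    have "cmod (integral {..Sup k} g - integral {..Inf k} g) \<le> M * (Sup k - Inf k) + integral k H"
      if k: "k \<in> D" for k
    proof -
      note iv = division_real_interval[OF D(1) k]
      have gi: "g absolutely_integrable_on {Inf k..Sup k}" by (auto intro!: set_integrable_subset[OF g])
      have "cmod (integral {..Sup k} g - integral {..Inf k} g) = cmod (integral {Inf k..Sup k} g)"
        using integral_atMost_diff[OF g iv(2)] by simp
      also have "\<dots> \<le> integral {Inf k..Sup k} (\<lambda>x. real M + H x)"
      proof (rule integral_norm_bound_integral)
        show "(\<lambda>x. real M + H x) integrable_on {Inf k..Sup k}"
          by (intro integrable_add Hi) auto
      qed (use set_lebesgue_integral_eq_integral(1)[OF gi] in \<open>auto simp: H_def\<close>)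
      also have "\<dots> = M * (Sup k - Inf k) + integral {Inf k..Sup k} H"
        using iv(2) by (subst integral_add) (auto intro: Hi)
      finally show ?thesis using iv(1) by simp
    qed
    then have "(\<Sum>k\<in>D. cmod (integral {..Sup k} g - integral {..Inf k} g))
        \<le> (\<Sum>k\<in>D. M * (Sup k - Inf k) + integral k H)" by (rule sum_mono)
    also have "\<dots> = M * (\<Sum>k\<in>D. Sup k - Inf k) + (\<Sum>k\<in>D. integral k H)"
      by (simp add: sum.distrib sum_distrib_left)
    also have "(\<Sum>k\<in>D. integral k H) = integral (\<Union>D) H"
      using D(1) Hi integral_combine_division_topdown lmeasurable_division
      by (metis fmeasurableD)
    also have "integral (\<Union>D) H \<le> integral UNIV H"
      by (intro integral_subset_le Hi fmeasurableD[OF lmeasurable_division[OF D(1)]]) (auto simp: H_def)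
    also have "M * (\<Sum>k\<in>D. Sup k - Inf k) \<le> M * \<delta>"
      using D(2) by (intro mult_left_mono) auto
    finally show ?thesis using \<delta> M by (simp add: H_def)
  qed
  then show "\<exists>\<delta>>0. \<forall>D. D division_of \<Union>D \<and> \<Union>D \<subseteq> {0..R} \<and> (\<Sum>k\<in>D. Sup k - Inf k) < \<delta> \<longrightarrow>
      (\<Sum>k\<in>D. cmod (integral {..Sup k} g - integral {..Inf k} g)) \<le> \<epsilon>"
    using \<delta>(1) by blast
qed

lemma continuous_on_integral_atMost:
  fixes g :: "real \<Rightarrow> 'a::euclidean_space"
  assumes g: "g absolutely_integrable_on UNIV"
  shows "continuous_on UNIV (\<lambda>x. integral {..x} g)"
proof -
  have "continuous_on {-r..r} (\<lambda>x. integral {..x} g)" for r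
  proof -
    have "g integrable_on {-r..r}"
      by (auto intro!: set_lebesgue_integral_eq_integral(1) set_integrable_subset[OF g])
    then have "continuous_on {-r..r} (\<lambda>x. integral {..-r} g + integral {-r..x} g)"
      by (intro continuous_intros indefinite_integral_continuous_1)
    moreover have "integral {..-r} g + integral {-r..x} g = integral {..x} g" if "x \<in> {-r..r}" for x
      using integral_atMost_diff[OF g, of "-r" x] that by (auto simp: algebra_simps)
    ultimately show ?thesis by (rule continuous_on_eq)
  qed
  then have c: "continuous_on {-r<..<r} (\<lambda>x. integral {..x} g)" for r
    by (rule continuous_on_subset[where s="{-r..r}"]) auto
  have "isCont (\<lambda>x. integral {..x} g) x" for x
    using c[of "\<bar>x\<bar> + 1"] by (rule continuous_on_interior) (auto simp: abs_real_def)
  then show ?thesis by (simp add: continuous_at_imp_continuous_on)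
qed

section \<open>Solutions at zero energy\<close>

lemma absolutely_integrable_on_UNIV_bound:
  fixes g :: "real \<Rightarrow> complex" and H :: "real \<Rightarrow> real"
  assumes "H absolutely_integrable_on UNIV" "g \<in> borel_measurable lebesgue" "\<And>x. cmod (g x) \<le> H x"
  shows "g absolutely_integrable_on UNIV"
proof -
  have "integrable lebesgue H" using assms by (simp add: set_integrable_def)
  then have "integrable lebesgue g"
  proof (rule Bochner_Integration.integrable_bound)
    show "AE x in lebesgue. norm (g x) \<le> norm (H x)"
      using assms(3) by (auto intro!: AE_I2 order_trans[OF assms(3)])
  qed (use assms in auto)
  then show ?thesis by (simp add: set_integrable_def)
qed

lemma norm_integral_atMost_le:
  fixes g :: "real \<Rightarrow> complex" and H :: "real \<Rightarrow> real"
  assumes H: "H absolutely_integrable_on UNIV" and g: "g absolutely_integrable_on UNIV"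
    and le: "\<And>x. cmod (g x) \<le> H x"
  shows "cmod (integral {..x} g) \<le> integral UNIV H"
proof -
  have i: "H integrable_on {..x}" "g integrable_on {..x}" "H integrable_on UNIV"
    using H by (auto intro!: set_lebesgue_integral_eq_integral(1) set_integrable_subset[OF H]
        set_integrable_subset[OF g])
  have "H t \<ge> 0" for t using le[of t] norm_ge_zero[of "g t"] by linarith
  then have "integral {..x} H \<le> integral UNIV H"
    using i by (intro integral_subset_le) auto
  moreover have "cmod (integral {..x} g) \<le> integral {..x} H"
    using i le by (intro integral_norm_bound_integral) auto
  ultimately show ?thesis by linarith
qed

lemma borel_measurable_lebesgue_continuous:
  fixes f :: "real \<Rightarrow> 'a::euclidean_space"
  assumes "continuous_on UNIV f"
  shows "f \<in> borel_measurable lebesgue"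
proof -
  have "f \<in> borel_measurable lborel" using assms by (simp add: borel_measurable_continuous_onI)
  then show ?thesis by (rule measurable_completion)
qed

lemma double_add_two_le:
  fixes x :: real
  shows "x + x + 1 + 1 \<le> 3 * (x\<^sup>2 + 1)"
proof -
  have "2 * x \<le> x\<^sup>2 + 1" using sum_squares_bound[of x 1] by simp
  moreover have "0 \<le> x\<^sup>2" by simp
  ultimately have "2 * x + 2 \<le> 3 * x\<^sup>2 + 3" by linarith
  then show ?thesis by simp
qed

text \<open>
  The map \<open>r \<mapsto> -\<integral> 1\<^sub>J (\<sigma> + r)\<^sup>2\<close> preserves the unit ball of the bounded continuous functions,
  because \<open>|\<sigma> + r|\<^sup>2 \<le> 2 (|\<sigma>|\<^sup>2 + 1)\<close> there, and it is a contraction with constant \<open>3/8\<close>, because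
  \<open>(\<sigma> + f)\<^sup>2 - (\<sigma> + g)\<^sup>2 = (f - g)(2\<sigma> + f + g)\<close> and \<open>|2\<sigma> + f + g| \<le> 3 (|\<sigma>|\<^sup>2 + 1)\<close>. The cut-off to
  \<open>J = {\<alpha>..\<beta>}\<close> makes the solution a function on the whole line that is constant on either side
  of \<open>J\<close>.
\<close>
lemma riccati_solution:
  fixes \<sigma> :: "real \<Rightarrow> complex" and \<alpha> \<beta> :: real
  defines "G \<equiv> \<lambda>x. indicator {\<alpha>..\<beta>} x * ((cmod (\<sigma> x))\<^sup>2 + 1)"
  assumes \<sigma>[measurable]: "\<sigma> \<in> borel_measurable lebesgue"
    and G: "G absolutely_integrable_on UNIV" and small: "integral UNIV G \<le> 1/8"
  obtains r where "continuous_on UNIV r" "\<And>x. cmod (r x) \<le> 1"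
    "\<And>x. r x = - integral {..x} (\<lambda>t. indicator {\<alpha>..\<beta>} t *\<^sub>R (\<sigma> t + r t)\<^sup>2)"
proof -
  define P where "P = (\<lambda>r t. indicator {\<alpha>..\<beta>} t *\<^sub>R (\<sigma> t + r t)\<^sup>2 :: complex)"
  have P_meas: "P r \<in> borel_measurable lebesgue" if "continuous_on UNIV r" for r
  proof -
    note r = borel_measurable_lebesgue_continuous[OF that]
    show ?thesis unfolding P_def
      by (intro borel_measurable_scaleR borel_measurable_power borel_measurable_add
          borel_measurable_indicator \<sigma> r) auto
  qed
  have P_bound: "cmod (P r t) \<le> 2 * G t" if "cmod (r t) \<le> 1" for r t
  proof -
    have "(cmod (\<sigma> t + r t))\<^sup>2 \<le> (cmod (\<sigma> t) + 1)\<^sup>2"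
      using norm_triangle_ineq[of "\<sigma> t" "r t"] that by (intro power_mono) auto
    also have "\<dots> \<le> 2 * ((cmod (\<sigma> t))\<^sup>2 + 1)"
      using zero_le_power2[of "cmod (\<sigma> t) - 1"] by (simp add: power2_eq_square algebra_simps)
    finally show ?thesis by (auto simp: P_def G_def norm_power indicator_def)
  qed
  have P_int: "P r absolutely_integrable_on UNIV" if "continuous_on UNIV r" "\<And>t. cmod (r t) \<le> 1" for r
    using P_bound[of r] that(2)
    by (intro absolutely_integrable_on_UNIV_bound[OF absolutely_integrable_scaleR_left[OF G, of 2]
          P_meas[OF that(1)]]) simp
  have I_bound: "cmod (integral {..x} (P r)) \<le> 1" if "continuous_on UNIV r" "\<And>t. cmod (r t) \<le> 1" for r x
  proof -
    have "cmod (integral {..x} (P r)) \<le> integral UNIV (\<lambda>t. 2 *\<^sub>R G t)"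
      using P_bound[of r] that(2) absolutely_integrable_scaleR_left[OF G, of 2]
      by (intro norm_integral_atMost_le P_int that) auto
    also have "\<dots> \<le> 1" using small by simp
    finally show ?thesis .
  qed
  define S where "S = (PiC UNIV (\<lambda>_. cball 0 1) :: (real \<Rightarrow>\<^sub>C complex) set)"
  have S: "f \<in> S \<longleftrightarrow> (\<forall>x. cmod (apply_bcontfun f x) \<le> 1)" for f
    by (auto simp: S_def mem_PiC_iff)
  define \<Phi> where "\<Phi> = (\<lambda>f. Bcontfun (\<lambda>x. - integral {..x} (P (apply_bcontfun f))))"
  have \<Phi>: "apply_bcontfun (\<Phi> f) x = - integral {..x} (P (apply_bcontfun f))" if "f \<in> S" for f x
  proof -
    have f: "continuous_on UNIV (apply_bcontfun f)" "\<And>t. cmod (apply_bcontfun f t) \<le> 1"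
      using that S by auto
    have "(\<lambda>x. - integral {..x} (P (apply_bcontfun f))) \<in> bcontfun"
      using I_bound[OF f] by (intro bcontfun_normI[where b=1] continuous_intros
          continuous_on_integral_atMost P_int f) auto
    then show ?thesis by (simp add: \<Phi>_def Bcontfun_inverse)
  qed
  have "\<exists>!f\<in>S. \<Phi> f = f"
  proof (rule Banach_fix[where c="3/8"])
    show "complete S" unfolding S_def complete_eq_closed by (intro closed_PiC) auto
    have "0 \<in> S" by (simp add: S)
    then show "S \<noteq> {}" by auto
    show "\<Phi> ` S \<subseteq> S"
      using I_bound by (auto simp: S \<Phi>)
    fix f g assume fg: "f \<in> S" "g \<in> S"
    let ?f = "apply_bcontfun f" and ?g = "apply_bcontfun g"
    have f: "continuous_on UNIV ?f" "\<And>t. cmod (?f t) \<le> 1" using fg S by auto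
    have g: "continuous_on UNIV ?g" "\<And>t. cmod (?g t) \<le> 1" using fg S by auto
    have b: "cmod (P ?f t - P ?g t) \<le> (3 * dist f g) *\<^sub>R G t" for t
    proof (cases "t \<in> {\<alpha>..\<beta>}")
      case True
      have le3: "cmod (\<sigma> t) + cmod (\<sigma> t) + 1 + 1 \<le> 3 * ((cmod (\<sigma> t))\<^sup>2 + 1)"
        by (rule double_add_two_le)
      have "P ?f t - P ?g t = (?f t - ?g t) * (\<sigma> t + \<sigma> t + ?f t + ?g t)"
        using True by (simp add: P_def power2_eq_square algebra_simps)
      then have "cmod (P ?f t - P ?g t) = dist (?f t) (?g t) * cmod (\<sigma> t + \<sigma> t + ?f t + ?g t)"
        by (simp add: norm_mult dist_norm)
      also have "\<dots> \<le> dist f g * (cmod (\<sigma> t) + cmod (\<sigma> t) + 1 + 1)"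
        using f(2)[of t] g(2)[of t]
        by (intro mult_mono dist_bounded norm_triangle_mono) auto
      also have "\<dots> \<le> dist f g * (3 * ((cmod (\<sigma> t))\<^sup>2 + 1))"
        by (intro mult_left_mono zero_le_dist le3)
      finally show ?thesis using True by (simp add: G_def algebra_simps)
    qed (simp add: P_def G_def)
    have "dist (apply_bcontfun (\<Phi> f) x) (apply_bcontfun (\<Phi> g) x) \<le> 3/8 * dist f g" for x
    proof -
      have i: "P ?f integrable_on {..x}" "P ?g integrable_on {..x}"
        using P_int[OF f] P_int[OF g]
        by (auto intro!: set_lebesgue_integral_eq_integral(1) elim: set_integrable_subset)
      have "dist (apply_bcontfun (\<Phi> f) x) (apply_bcontfun (\<Phi> g) x)
          = cmod (integral {..x} (P ?f) - integral {..x} (P ?g))"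
        using fg by (simp add: \<Phi> dist_norm norm_minus_commute)
      also have "\<dots> = cmod (integral {..x} (\<lambda>t. P ?f t - P ?g t))"
        using i by (simp add: integral_diff)
      also have "\<dots> \<le> integral UNIV (\<lambda>t. (3 * dist f g) *\<^sub>R G t)"
        by (intro norm_integral_atMost_le absolutely_integrable_scaleR_left G b
            set_integral_diff P_int f g)
      also have "\<dots> \<le> 3/8 * dist f g"
        using mult_left_mono[OF small zero_le_dist[of f g]] by (simp add: mult_ac)
      finally show ?thesis .
    qed
    then show "dist (\<Phi> f) (\<Phi> g) \<le> 3/8 * dist f g" by (rule dist_bound)
  qed auto
  then obtain f where f: "f \<in> S" "\<Phi> f = f" by blast
  then have eq: "apply_bcontfun f x = - integral {..x} (P (apply_bcontfun f))" for x
    using \<Phi>[OF f(1), of x] by simp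
  show ?thesis
  proof (rule that[of "apply_bcontfun f"])
    show "cmod (apply_bcontfun f x) \<le> 1" for x using f(1) by (simp add: S)
    show "apply_bcontfun f x
        = - integral {..x} (\<lambda>t. indicator {\<alpha>..\<beta>} t *\<^sub>R (\<sigma> t + apply_bcontfun f t)\<^sup>2)" for x
      using eq[of x] unfolding P_def .
  qed simp
qed

text \<open>
  On \<open>{\<alpha>..\<beta>}\<close> the function \<open>w = exp (\<integral> q)\<close> solves \<open>l(w) = 0\<close> for the potential \<open>\<sigma>'\<close>, and \<open>r w\<close> is
  its quasi-derivative \<open>w' - \<sigma> w\<close>. The exponent is at most \<open>1/4\<close> in absolute value, which keeps
  \<open>w\<close> away from \<open>0\<close> and \<open>\<infinity>\<close>.
\<close>
lemma zero_energy_solution: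
  fixes \<sigma> :: "real \<Rightarrow> complex" and \<alpha> \<beta> :: real
  defines "G \<equiv> \<lambda>x. indicator {\<alpha>..\<beta>} x * ((cmod (\<sigma> x))\<^sup>2 + 1)"
  assumes \<sigma>: "\<sigma> \<in> borel_measurable lebesgue"
    and G: "G absolutely_integrable_on UNIV" and small: "integral UNIV G \<le> 1/8"
  obtains r w q where
    "continuous_on UNIV r" "AC_loc r" "\<And>x. cmod (r x) \<le> 1"
    "continuous_on UNIV w" "AC_loc w" "\<And>x. 1/2 \<le> cmod (w x)" "\<And>x. cmod (w x) \<le> 2"
    "\<And>x. q x = indicator {\<alpha>..\<beta>} x *\<^sub>R (\<sigma> x + r x)"
    "AE x in lebesgue. (r has_vector_derivative - (q x)\<^sup>2) (at x)"
    "AE x in lebesgue. (w has_vector_derivative q x * w x) (at x)"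
proof -
  obtain r where r: "continuous_on UNIV r" "\<And>x. cmod (r x) \<le> 1"
    and r_eq: "\<And>x. r x = - integral {..x} (\<lambda>t. indicator {\<alpha>..\<beta>} t *\<^sub>R (\<sigma> t + r t)\<^sup>2)"
    using riccati_solution[of \<sigma> \<alpha> \<beta>] \<sigma> G small unfolding G_def by blast
  define q where "q = (\<lambda>x. indicator {\<alpha>..\<beta>} x *\<^sub>R (\<sigma> x + r x))"
  have q_meas: "q \<in> borel_measurable lebesgue"
    unfolding q_def using borel_measurable_lebesgue_continuous[OF r(1)] \<sigma>
    by (intro borel_measurable_scaleR borel_measurable_add borel_measurable_indicator) auto
  have q2_bound: "cmod (- (q x)\<^sup>2) \<le> 2 *\<^sub>R G x" for x
  proof -
    have "(cmod (\<sigma> x + r x))\<^sup>2 \<le> (cmod (\<sigma> x) + 1)\<^sup>2"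
      using norm_triangle_ineq[of "\<sigma> x" "r x"] r(2)[of x] by (intro power_mono) auto
    also have "\<dots> \<le> 2 * ((cmod (\<sigma> x))\<^sup>2 + 1)"
      using zero_le_power2[of "cmod (\<sigma> x) - 1"] by (simp add: power2_eq_square algebra_simps)
    finally show ?thesis by (auto simp: q_def G_def norm_power indicator_def)
  qed
  have q_bound: "cmod (q x) \<le> 2 *\<^sub>R G x" for x
  proof -
    have "cmod (\<sigma> x + r x) \<le> cmod (\<sigma> x) + 1"
      using norm_triangle_ineq[of "\<sigma> x" "r x"] r(2)[of x] by linarith
    also have "\<dots> \<le> 2 * ((cmod (\<sigma> x))\<^sup>2 + 1)"
      using sum_power2_ge_zero[of "cmod (\<sigma> x) - 1/2" "cmod (\<sigma> x)"]
      by (simp add: power2_eq_square algebra_simps)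
    finally show ?thesis by (auto simp: q_def G_def indicator_def)
  qed
  note G2 = absolutely_integrable_scaleR_left[OF G, of 2]
  have q_int: "q absolutely_integrable_on UNIV"
    by (rule absolutely_integrable_on_UNIV_bound[OF G2 q_meas q_bound])
  have q2_int: "(\<lambda>x. - (q x)\<^sup>2) absolutely_integrable_on UNIV"
    using q_meas by (intro absolutely_integrable_on_UNIV_bound[OF G2 _ q2_bound]) simp
  have r_int: "r = (\<lambda>x. integral {..x} (\<lambda>t. - (q t)\<^sup>2))"
  proof
    fix x
    have "integral {..x} (\<lambda>t. (q t)\<^sup>2) = integral {..x} (\<lambda>t. indicator {\<alpha>..\<beta>} t *\<^sub>R (\<sigma> t + r t)\<^sup>2)"
      by (rule arg_cong[where f="integral {..x}"]) (rule ext, simp add: q_def indicator_def)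
    then show "r x = integral {..x} (\<lambda>t. - (q t)\<^sup>2)"
      unfolding r_eq[of x] integral_neg by simp
  qed
  define S where "S = (\<lambda>x. integral {..x} q)"
  have S: "cmod (S x) \<le> 1/4" for x
    using norm_integral_atMost_le[OF G2 q_int q_bound, of x] small by (simp add: S_def)
  have e4: "exp (1/4 :: real) \<le> 2"
    using exp_bound[of "1/4::real"] by (simp add: power2_eq_square)
  have AC_S: "AC_loc S" unfolding S_def by (rule AC_loc_integral_atMost[OF q_int])
  have cont_S: "continuous_on UNIV S" unfolding S_def by (rule continuous_on_integral_atMost[OF q_int])
  show ?thesis
  proof (rule that[of r "\<lambda>x. exp (S x)" q])
    show "continuous_on UNIV r" "\<And>x. cmod (r x) \<le> 1" by (fact r)+
    show "AC_loc r" unfolding r_int by (rule AC_loc_integral_atMost[OF q2_int])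
    show "continuous_on UNIV (\<lambda>x. exp (S x))" by (intro continuous_intros cont_S)
    show "AC_loc (\<lambda>x. exp (S x))"
      by (rule AC_loc_lipschitz_comp[OF AC_S, where C="exp (1/4)"])
        (auto intro!: exp_lipschitz_on_cball S)
    have ReS: "\<bar>Re (S x)\<bar> \<le> 1/4" for x
      using abs_Re_le_cmod[of "S x"] S[of x] by linarith
    show "cmod (exp (S x)) \<le> 2" for x
    proof -
      have "exp (Re (S x)) \<le> exp (1/4)" using ReS[of x] by simp
      then show ?thesis using e4 unfolding norm_exp_eq_Re by linarith
    qed
    show "1/2 \<le> cmod (exp (S x))" for x
      using exp_ge_add_one_self[of "Re (S x)"] ReS[of x] unfolding norm_exp_eq_Re by linarith
    show "q x = indicator {\<alpha>..\<beta>} x *\<^sub>R (\<sigma> x + r x)" for x by (simp add: q_def)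
    show "AE x in lebesgue. (r has_vector_derivative - (q x)\<^sup>2) (at x)"
      using AE_has_vector_derivative_integral_atMost[OF q2_int] unfolding r_int[symmetric] .
    have "AE x in lebesgue. (S has_vector_derivative q x) (at x)"
      using AE_has_vector_derivative_integral_atMost[OF q_int] unfolding S_def[symmetric] .
    then show "AE x in lebesgue. ((\<lambda>x. exp (S x)) has_vector_derivative q x * exp (S x)) (at x)"
    proof eventually_elim
      case (elim x)
      show ?case
        using field_vector_diff_chain_at[OF elim DERIV_exp] by (simp add: o_def)
    qed
  qed
qed

section \<open>Norms in \<open>L\<^sub>2\<close> of the half-line\<close>

lemma L2I:
  assumes "f \<in> borel_measurable lebesgue" "integrable lebesgue (\<lambda>x. indicator {0..} x * (cmod (f x))\<^sup>2)"
  shows "f \<in> L2"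
proof -
  have "integrable (lebesgue_on {0..}) (\<lambda>x. (cmod (f x))\<^sup>2)"
    using assms(2) by (subst integrable_restrict_space) (auto simp: set_integrable_def)
  moreover have "f \<in> borel_measurable (lebesgue_on {0..})"
    using assms(1) by (rule measurable_restrict_space1)
  ultimately show ?thesis by (simp add: square_integrable_def)
qed

lemma L2_norm_eq:
  "L2_norm f = sqrt (LINT x|lebesgue. indicator {0..} x * (cmod (f x))\<^sup>2)"
  unfolding L2_norm_def by (subst integral_restrict_space) auto

text \<open>
  Lebesgue measure is complete, so measurability passes to functions that agree almost everywhere.
\<close>
lemma L2_cong:
  assumes f: "f \<in> L2" and eq: "L2_eq f g"
  shows "g \<in> L2"
proof -
  have "(\<lambda>x. if x \<in> {0..} then f x else 0) \<in> borel_measurable lebesgue"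
    using f by (subst borel_measurable_if) (auto simp: square_integrable_def)
  moreover have "AE x in lebesgue. (if x \<in> {0..} then f x else 0) = (if x \<in> {0..} then g x else 0)"
    using eq unfolding L2_eq_def by (subst (asm) AE_restrict_space_iff) auto
  ultimately have "(\<lambda>x. if x \<in> {0..} then g x else 0) \<in> borel_measurable lebesgue"
    by (rule borel_measurable_AE)
  then have m: "g \<in> borel_measurable (lebesgue_on {0..})"
    by (subst (asm) borel_measurable_if) auto
  have "integrable (lebesgue_on {0..}) (\<lambda>x. (cmod (g x))\<^sup>2)"
  proof (rule integrable_cong_AE_imp)
    show "integrable (lebesgue_on {0..}) (\<lambda>x. (cmod (f x))\<^sup>2)"
      using f by (simp add: square_integrable_def)
    show "AE x in lebesgue_on {0..}. (cmod (f x))\<^sup>2 = (cmod (g x))\<^sup>2"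
      using eq unfolding L2_eq_def by eventually_elim simp
    show "(\<lambda>x. (cmod (g x))\<^sup>2) \<in> borel_measurable (lebesgue_on {0..})" using m by simp
  qed
  with m show ?thesis by (simp add: square_integrable_def)
qed

lemma L2_bound:
  assumes f: "f \<in> borel_measurable lebesgue" and H: "integrable lebesgue H"
    and le: "\<And>x. (cmod (f x))\<^sup>2 \<le> H x" and K: "integral\<^sup>L lebesgue H \<le> K\<^sup>2" "K \<ge> 0"
  shows "f \<in> L2" "L2_norm f \<le> K"
proof -
  have le': "indicator {0..} x * (cmod (f x))\<^sup>2 \<le> H x" for x
    using le[of x] by (auto simp: indicator_def intro: order_trans[OF zero_le_power2])
  have "integrable lebesgue (\<lambda>x. indicator {0..} x * (cmod (f x))\<^sup>2)"
  proof (rule Bochner_Integration.integrable_bound[OF H])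
    show "(\<lambda>x. indicator {0..} x * (cmod (f x))\<^sup>2) \<in> borel_measurable lebesgue"
      using f by (intro borel_measurable_times borel_measurable_indicator) auto
    show "AE x in lebesgue. norm (indicator {0..} x * (cmod (f x))\<^sup>2) \<le> norm (H x)"
      using le' by (auto intro!: AE_I2 order_trans[OF le'])
  qed
  then show "f \<in> L2" "L2_norm f \<le> K"
    using L2I[OF f] integral_mono[OF _ H le'] K
    by (auto simp: L2_norm_eq intro!: real_le_lsqrt)
qed

lemma L2_diff:
  assumes f: "f \<in> L2" and g: "g \<in> L2"
  shows "(\<lambda>x. f x - g x) \<in> L2"
    and "(L2_norm (\<lambda>x. f x - g x))\<^sup>2 \<le> 2 * (L2_norm f)\<^sup>2 + 2 * (L2_norm g)\<^sup>2"
proof -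
  let ?M = "lebesgue_on {0::real..}"
  have fm: "f \<in> borel_measurable ?M" "integrable ?M (\<lambda>x. (cmod (f x))\<^sup>2)"
    and gm: "g \<in> borel_measurable ?M" "integrable ?M (\<lambda>x. (cmod (g x))\<^sup>2)"
    using f g by (auto simp: square_integrable_def)
  have le: "(cmod (f x - g x))\<^sup>2 \<le> 2 * (cmod (f x))\<^sup>2 + 2 * (cmod (g x))\<^sup>2" for x
  proof -
    have "(cmod (f x - g x))\<^sup>2 \<le> (cmod (f x) + cmod (g x))\<^sup>2"
      by (intro power_mono norm_triangle_ineq4) auto
    also have "\<dots> \<le> 2 * (cmod (f x))\<^sup>2 + 2 * (cmod (g x))\<^sup>2"
      using sum_squares_bound[of "cmod (f x)" "cmod (g x)"] by (simp add: power2_sum)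
    finally show ?thesis .
  qed
  have b: "integrable ?M (\<lambda>x. 2 * (cmod (f x))\<^sup>2 + 2 * (cmod (g x))\<^sup>2)"
    using fm gm by auto
  have d: "integrable ?M (\<lambda>x. (cmod (f x - g x))\<^sup>2)"
  proof (rule Bochner_Integration.integrable_bound[OF b])
    show "(\<lambda>x. (cmod (f x - g x))\<^sup>2) \<in> borel_measurable ?M" using fm gm by simp
    show "AE x in ?M. norm ((cmod (f x - g x))\<^sup>2) \<le> norm (2 * (cmod (f x))\<^sup>2 + 2 * (cmod (g x))\<^sup>2)"
      using le by (intro AE_I2) simp
  qed
  then show "(\<lambda>x. f x - g x) \<in> L2" using fm gm by (simp add: square_integrable_def)
  have sq: "(L2_norm h)\<^sup>2 = (LINT x|?M. (cmod (h x))\<^sup>2)" for h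
    by (simp add: L2_norm_def)
  have "(L2_norm (\<lambda>x. f x - g x))\<^sup>2 \<le> (LINT x|?M. 2 * (cmod (f x))\<^sup>2 + 2 * (cmod (g x))\<^sup>2)"
    unfolding sq by (rule integral_mono[OF d b le])
  also have "\<dots> = 2 * (L2_norm f)\<^sup>2 + 2 * (L2_norm g)\<^sup>2"
    unfolding sq using fm gm by (subst Bochner_Integration.integral_add) auto
  finally show "(L2_norm (\<lambda>x. f x - g x))\<^sup>2 \<le> 2 * (L2_norm f)\<^sup>2 + 2 * (L2_norm g)\<^sup>2" .
qed

lemma L2_norm_cmult: "L2_norm (\<lambda>x. c * f x) = cmod c * L2_norm f"
  by (simp add: L2_norm_def norm_mult power_mult_distrib real_sqrt_mult)

lemma L2_cmult: "f \<in> L2 \<Longrightarrow> (\<lambda>x. c * f x) \<in> L2"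
  by (auto simp: square_integrable_def norm_mult power_mult_distrib)

lemma L2_norm_nonneg: "0 \<le> L2_norm f"
  by (simp add: L2_norm_def)

lemma L2_norm_le_diff_disjoint:
  assumes f: "f \<in> L2" and g: "g \<in> L2" and dis: "\<And>x. f x = 0 \<or> g x = 0"
  shows "L2_norm f \<le> L2_norm (\<lambda>x. f x - g x)"
  unfolding L2_norm_def
proof (intro real_sqrt_le_mono integral_mono)
  fix x
  show "(cmod (f x))\<^sup>2 \<le> (cmod (f x - g x))\<^sup>2" using dis[of x] by auto
qed (use f L2_diff(1)[OF f g] in \<open>auto simp: square_integrable_def\<close>)

section \<open>Test functions on short intervals\<close>

definition bump :: "real \<Rightarrow> real \<Rightarrow> real \<Rightarrow> real" where
  "bump \<alpha> \<beta> x = max 0 ((x - \<alpha>) * (\<beta> - x))"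

lemma bump_outside: "\<alpha> \<le> \<beta> \<Longrightarrow> x \<notin> {\<alpha><..<\<beta>} \<Longrightarrow> bump \<alpha> \<beta> x = 0"
  by (auto simp: bump_def max_def mult_le_0_iff not_less dest: antisym)

lemma continuous_on_bump: "continuous_on UNIV (\<lambda>x. complex_of_real (bump \<alpha> \<beta> x))"
  unfolding bump_def by (intro continuous_intros)

lemma AC_loc_bump: "AC_loc (\<lambda>x. complex_of_real (bump \<alpha> \<beta> x))"
proof -
  have p: "AC_loc (\<lambda>x. (complex_of_real x + - of_real \<alpha>) * (of_real \<beta> + (-1) * of_real x))"
    by (intro AC_loc_mult AC_loc_add AC_loc_const AC_loc_of_real continuous_intros)
  have lip: "cmod (of_real (max 0 (Re z)) - of_real (max 0 (Re w))) \<le> 1 * cmod (z - w)" for z w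
  proof -
    have "cmod (of_real (max 0 (Re z)) - of_real (max 0 (Re w))) = \<bar>max 0 (Re z) - max 0 (Re w)\<bar>"
      by (simp flip: of_real_diff)
    also have "\<dots> \<le> \<bar>Re (z - w)\<bar>" by (auto simp: max_def)
    finally show ?thesis using abs_Re_le_cmod[of "z - w"] by simp
  qed
  have "AC_loc (\<lambda>x. complex_of_real (max 0 (Re
      ((complex_of_real x + - of_real \<alpha>) * (of_real \<beta> + (-1) * of_real x)))))"
    by (rule AC_loc_lipschitz_comp[OF p _ lip]) simp
  then show ?thesis by (simp add: bump_def algebra_simps)
qed

lemma bump_has_vector_derivative:
  assumes "\<alpha> \<le> \<beta>" "x \<noteq> \<alpha>" "x \<noteq> \<beta>"
  shows "((\<lambda>x. complex_of_real (bump \<alpha> \<beta> x)) has_vector_derivative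
      of_real (indicator {\<alpha>..\<beta>} x * (\<alpha> + \<beta> - 2 * x))) (at x)"
proof (cases "x \<in> {\<alpha><..<\<beta>}")
  case True
  have "((\<lambda>x. (x - \<alpha>) * (\<beta> - x)) has_real_derivative (\<alpha> + \<beta> - 2 * x)) (at x)"
    by (auto intro!: derivative_eq_intros)
  then have "((\<lambda>x. complex_of_real ((x - \<alpha>) * (\<beta> - x))) has_vector_derivative
      of_real (\<alpha> + \<beta> - 2 * x)) (at x)"
    by (intro has_vector_derivative_of_real) 
  then have "((\<lambda>x. complex_of_real (bump \<alpha> \<beta> x)) has_vector_derivative
      of_real (\<alpha> + \<beta> - 2 * x)) (at x)"
    by (rule has_vector_derivative_transform_within_open[where S="{\<alpha><..<\<beta>}"])
      (use True in \<open>auto simp: bump_def\<close>)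
  then show ?thesis using True by simp
next
  case False
  then have out: "x \<in> - {\<alpha>..\<beta>}" using assms by auto
  have "((\<lambda>x. complex_of_real (bump \<alpha> \<beta> x)) has_vector_derivative 0) (at x)"
    by (rule has_vector_derivative_transform_within_open[where S="- {\<alpha>..\<beta>}" and f="\<lambda>_. 0"])
      (use out assms bump_outside in auto)
  then show ?thesis using out by simp
qed

text \<open>
  The solution \<open>w\<close> of \<open>l(w) = 0\<close> is cut off by the square of the bump \<open>\<phi>\<close>. One factor \<open>\<phi>\<close> would
  leave the jump of \<open>\<phi>'\<close> in the quasi-derivative; with \<open>\<phi>\<^sup>2\<close> the quasi-derivative is absolutely
  continuous too. The product rule gives \<open>l(\<phi>\<^sup>2 w) = -(\<phi>\<^sup>2)'' w - 2 (\<phi>\<^sup>2)' w'\<close>, where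
  \<open>w' = q w\<close> is square integrable.
\<close>
lemma test_function_on_short_interval:
  assumes J: "0 \<le> \<alpha>" "\<alpha> < \<beta>" "\<beta> \<le> \<alpha> + 1"
    and s: "s \<in> square_integrable_loc"
    and int: "integrable lebesgue (\<lambda>x. indicator {\<alpha>..\<beta>} x * ((cmod (s x - c))\<^sup>2 + 1))"
    and small: "(LINT x|lebesgue. indicator {\<alpha>..\<beta>} x * ((cmod (s x - c))\<^sup>2 + 1)) \<le> 1/8"
  obtains y g where "(y, g) \<in> minimal_operator s" "\<And>x. x \<notin> {\<alpha>..\<beta>} \<Longrightarrow> y x = 0"
    "L2_norm g \<le> 10" "L2_norm y \<le> 2" "((\<beta> - \<alpha>) / 4) ^ 5 \<le> L2_norm y"
proof -
  define \<sigma> where "\<sigma> = (\<lambda>x. if x \<in> {0..\<beta>} then s x - c else 0)"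
  define G where "G = (\<lambda>x. indicator {\<alpha>..\<beta>} x * ((cmod (\<sigma> x))\<^sup>2 + 1))"
  have G_eq: "G = (\<lambda>x. indicator {\<alpha>..\<beta>} x * ((cmod (s x - c))\<^sup>2 + 1))"
    using J by (auto simp: G_def \<sigma>_def indicator_def)
  have "s \<in> borel_measurable (lebesgue_on {0..\<beta>})"
    using s J by (auto simp: square_integrable_loc_def square_integrable_def)
  then have \<sigma>_meas: "\<sigma> \<in> borel_measurable lebesgue"
    unfolding \<sigma>_def by (subst borel_measurable_if) auto
  have G_int: "integrable lebesgue G" and G_small: "integral\<^sup>L lebesgue G \<le> 1/8"
    using int small by (auto simp: G_eq)
  then have G_ai: "G absolutely_integrable_on UNIV" by (simp add: set_integrable_def)
  have G_small': "integral UNIV G \<le> 1/8"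
    using set_lebesgue_integral_eq_integral(2)[OF G_ai] G_small by (simp add: set_lebesgue_integral_def)
  obtain r w q where r: "continuous_on UNIV r" "AC_loc r" "\<And>x. cmod (r x) \<le> 1"
    and w: "continuous_on UNIV w" "AC_loc w" "\<And>x. 1/2 \<le> cmod (w x)" "\<And>x. cmod (w x) \<le> 2"
    and q: "\<And>x. q x = indicator {\<alpha>..\<beta>} x *\<^sub>R (\<sigma> x + r x)"
    and r': "AE x in lebesgue. (r has_vector_derivative - (q x)\<^sup>2) (at x)"
    and w': "AE x in lebesgue. (w has_vector_derivative q x * w x) (at x)"
    by (rule zero_energy_solution[OF \<sigma>_meas G_ai[unfolded G_def] G_small'[unfolded G_def]]) blast
  define \<phi> where "\<phi> = (\<lambda>x. complex_of_real (bump \<alpha> \<beta> x))"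
  define \<tau> where "\<tau> = (\<lambda>x. complex_of_real \<alpha> + of_real \<beta> + (-2) * of_real x)"
  define y where "y = (\<lambda>x. (\<phi> x * \<phi> x) * w x)"
  \<comment> \<open>The quasi-derivative with respect to \<open>s\<close>, not to \<open>\<sigma>\<close>: hence \<open>r - c\<close> in place of \<open>r\<close>.\<close>
  define u where "u = (\<lambda>x. (2 * (\<phi> x * \<tau> x) + (\<phi> x * \<phi> x) * (r x + - c)) * w x)"
  define g where "g = (\<lambda>x. - (indicator {\<alpha>..\<beta>} x *\<^sub>R
      (w x * (2 * (\<tau> x)\<^sup>2 - 4 * \<phi> x + 4 * \<phi> x * \<tau> x * q x))))"
  have \<phi>_out: "\<phi> x = 0" if "x \<notin> {\<alpha><..<\<beta>}" for x
    using bump_outside[of \<alpha> \<beta> x] that J by (simp add: \<phi>_def)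
  have cont: "continuous_on UNIV \<phi>" "continuous_on UNIV \<tau>"
    unfolding \<phi>_def \<tau>_def by (intro continuous_on_bump continuous_intros)+
  have AC: "AC_loc \<phi>" "AC_loc \<tau>"
    unfolding \<phi>_def \<tau>_def by (intro AC_loc_bump AC_loc_add AC_loc_mult AC_loc_const AC_loc_of_real continuous_intros)+
  have cont_y: "continuous_on UNIV y" unfolding y_def by (intro continuous_intros cont w)
  have AC_y: "AC_loc y" unfolding y_def by (intro AC_loc_mult continuous_intros cont w AC)
  have AC_u: "AC_loc u" unfolding u_def
    by (intro AC_loc_mult AC_loc_add AC_loc_const continuous_intros cont w r AC)
  \<comment> \<open>Off the end points of \<open>{\<alpha>..\<beta>}\<close> and off the exceptional null sets of \<open>r\<close> and
    \<open>w\<close> this is the product rule. Inside, \<open>s = q - r + c\<close>; outside, \<open>\<phi>\<close>, its derivative and \<open>q\<close> vanish.\<close>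
  have y': "AE x in lebesgue. x \<in> {0..} \<longrightarrow>
      u x = vector_derivative y (at x) - s x * y x \<and> g x = l_expr s y u x"
  proof -
    have ne: "AE x in lebesgue. x \<noteq> \<alpha>" "AE x in lebesgue. x \<noteq> \<beta>"
      by (auto intro: AE_completion AE_lborel_singleton)
    show ?thesis using r' w' ne
    proof eventually_elim
      case (elim x)
      define d where "d = complex_of_real (indicator {\<alpha>..\<beta>} x * (\<alpha> + \<beta> - 2 * x))"
      have \<phi>': "(\<phi> has_vector_derivative d) (at x)"
        unfolding \<phi>_def d_def using elim J by (intro bump_has_vector_derivative) auto
      have \<tau>': "(\<tau> has_vector_derivative - 2) (at x)"
        unfolding \<tau>_def by (auto intro!: derivative_eq_intros)
      have y': "(y has_vector_derivative (\<phi> x * \<phi> x) * (q x * w x) + (\<phi> x * d + d * \<phi> x) * w x) (at x)"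
        unfolding y_def by (intro has_vector_derivative_mult \<phi>' elim)
      have c': "((\<lambda>x. r x + - c) has_vector_derivative - (q x)\<^sup>2 + 0) (at x)"
        by (intro has_vector_derivative_add has_vector_derivative_const elim)
      have u': "(u has_vector_derivative
          (2 * (\<phi> x * \<tau> x) + (\<phi> x * \<phi> x) * (r x + - c)) * (q x * w x) +
          ((2 * (\<phi> x * - 2 + d * \<tau> x) + 0 * (\<phi> x * \<tau> x))
            + ((\<phi> x * \<phi> x) * (- (q x)\<^sup>2 + 0) + (\<phi> x * d + d * \<phi> x) * (r x + - c))) * w x) (at x)"
        unfolding u_def
        by (intro has_vector_derivative_mult has_vector_derivative_add has_vector_derivative_const \<phi>' \<tau>' c' elim)
      note vy = vector_derivative_at[OF y'] and vu = vector_derivative_at[OF u']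
      show ?case
      proof (cases "x \<in> {\<alpha>..\<beta>}")
        case True
        then have d: "d = \<tau> x" by (simp add: d_def \<tau>_def)
        have sx: "s x = q x - r x + c" using True J by (simp add: q \<sigma>_def)
        show ?thesis
          unfolding l_expr_def vy vu d sx using True
          by (simp add: u_def y_def g_def power2_eq_square algebra_simps)
      next
        case False
        then have "d = 0" "\<phi> x = 0" "q x = 0" using \<phi>_out[of x] by (auto simp: d_def q)
        then show ?thesis using False unfolding l_expr_def vy vu
          by (simp add: u_def y_def g_def)
      qed
    qed
  qed
  have q_meas: "q \<in> borel_measurable lebesgue"
    unfolding q[abs_def] using borel_measurable_lebesgue_continuous[OF r(1)] \<sigma>_meas
    by (intro borel_measurable_scaleR borel_measurable_add borel_measurable_indicator) auto
  have g_meas: "g \<in> borel_measurable lebesgue"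
    unfolding g_def using borel_measurable_lebesgue_continuous[OF cont(1)]
      borel_measurable_lebesgue_continuous[OF cont(2)] borel_measurable_lebesgue_continuous[OF w(1)] q_meas
    by (intro borel_measurable_scaleR borel_measurable_add borel_measurable_indicator
        borel_measurable_uminus borel_measurable_times borel_measurable_diff borel_measurable_power
        borel_measurable_const) auto
  have \<tau>_le: "cmod (\<tau> x) \<le> 1" if "x \<in> {\<alpha>..\<beta>}" for x
  proof -
    have "\<tau> x = of_real (\<alpha> + \<beta> - 2 * x)" by (simp add: \<tau>_def)
    then have "cmod (\<tau> x) = \<bar>\<alpha> + \<beta> - 2 * x\<bar>" by (simp only: norm_of_real)
    then show ?thesis using that J by auto
  qed
  have \<phi>_le: "cmod (\<phi> x) \<le> 1" if "x \<in> {\<alpha>..\<beta>}" for x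
  proof -
    have "(x - \<alpha>) * (\<beta> - x) \<le> 1 * 1" using that J by (intro mult_mono) auto
    then show ?thesis by (simp add: \<phi>_def bump_def)
  qed
  \<comment> \<open>Here \<open>|2\<tau>\<^sup>2 - 4\<phi> + 4\<phi>\<tau>q| \<le> 10 + 4|\<sigma>|\<close> and \<open>|w| \<le> 2\<close>;
    the factor 800 combines with the bound 1/8 for the integral of \<open>G\<close> to \<open>10\<^sup>2\<close>.\<close>
  have g_le: "(cmod (g x))\<^sup>2 \<le> 800 * G x" for x
  proof (cases "x \<in> {\<alpha>..\<beta>}")
    case True
    have "cmod (q x) \<le> cmod (\<sigma> x) + 1"
      using True norm_triangle_ineq[of "\<sigma> x" "r x"] r(3)[of x] by (simp add: q)
    then have "cmod (4 * \<phi> x * \<tau> x * q x) \<le> 4 * 1 * 1 * (cmod (\<sigma> x) + 1)"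
      unfolding norm_mult using \<phi>_le[OF True] \<tau>_le[OF True] by (intro mult_mono) auto
    then have "cmod (4 * \<phi> x * \<tau> x * q x) \<le> 4 * cmod (\<sigma> x) + 4" by simp
    moreover have "cmod (2 * (\<tau> x)\<^sup>2) \<le> 2"
      unfolding norm_mult norm_power using \<tau>_le[OF True] by (simp add: power_le_one)
    moreover have "cmod (4 * \<phi> x) \<le> 4" unfolding norm_mult using \<phi>_le[OF True] by simp
    moreover have "cmod (2 * (\<tau> x)\<^sup>2 - 4 * \<phi> x + 4 * \<phi> x * \<tau> x * q x)
        \<le> cmod (2 * (\<tau> x)\<^sup>2) + cmod (4 * \<phi> x) + cmod (4 * \<phi> x * \<tau> x * q x)"
      using norm_triangle_ineq[of "2 * (\<tau> x)\<^sup>2 - 4 * \<phi> x" "4 * \<phi> x * \<tau> x * q x"]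
        norm_triangle_ineq4[of "2 * (\<tau> x)\<^sup>2" "4 * \<phi> x"] by linarith
    ultimately have "cmod (2 * (\<tau> x)\<^sup>2 - 4 * \<phi> x + 4 * \<phi> x * \<tau> x * q x) \<le> 10 + 4 * cmod (\<sigma> x)"
      by linarith
    then have "cmod (w x) * cmod (2 * (\<tau> x)\<^sup>2 - 4 * \<phi> x + 4 * \<phi> x * \<tau> x * q x)
        \<le> 2 * (10 + 4 * cmod (\<sigma> x))"
      using w(4)[of x] by (intro mult_mono) auto
    then have "cmod (g x) \<le> 2 * (10 + 4 * cmod (\<sigma> x))"
      using True by (simp only: g_def norm_minus_cancel norm_mult indicator_simps scaleR_one)
    then have "(cmod (g x))\<^sup>2 \<le> (2 * (10 + 4 * cmod (\<sigma> x)))\<^sup>2" by (intro power_mono) auto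
    also have "\<dots> \<le> 800 * ((cmod (\<sigma> x))\<^sup>2 + 1)"
    proof -
      have "800 * ((cmod (\<sigma> x))\<^sup>2 + 1) - (2 * (10 + 4 * cmod (\<sigma> x)))\<^sup>2
          = (20 - 8 * cmod (\<sigma> x))\<^sup>2 + 672 * (cmod (\<sigma> x))\<^sup>2"
        by (simp add: power2_eq_square algebra_simps)
      moreover have "0 \<le> (20 - 8 * cmod (\<sigma> x))\<^sup>2 + 672 * (cmod (\<sigma> x))\<^sup>2" by simp
      ultimately show ?thesis by (metis diff_ge_0_iff_ge)
    qed
    finally show ?thesis using True by (simp add: G_def)
  qed (simp add: g_def G_def)
  have G800: "integrable lebesgue (\<lambda>x. 800 * G x)" "(LINT x|lebesgue. 800 * G x) \<le> 10\<^sup>2"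
    using G_int G_small by auto
  have g_L2: "g \<in> L2" "L2_norm g \<le> 10"
    by (rule L2_bound[OF g_meas G800(1) g_le G800(2)]; simp)+
  have y_meas: "y \<in> borel_measurable lebesgue" by (rule borel_measurable_lebesgue_continuous[OF cont_y])
  have y_out: "y x = 0" if "x \<notin> {\<alpha>..\<beta>}" for x using \<phi>_out[of x] that by (auto simp: y_def)
  have y_le: "(cmod (y x))\<^sup>2 \<le> indicator {\<alpha>..\<beta>} x * 4" for x
  proof (cases "x \<in> {\<alpha>..\<beta>}")
    case True
    then have "cmod (y x) \<le> (1 * 1) * 2"
      unfolding y_def norm_mult using \<phi>_le[OF True] w(4)[of x] by (intro mult_mono) auto
    then have "(cmod (y x))\<^sup>2 \<le> 2\<^sup>2" by (intro power_mono) auto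
    then show ?thesis using True by simp
  qed (simp add: y_out)
  have y_L2: "y \<in> L2" "L2_norm y \<le> 2"
    by (rule L2_bound[OF y_meas _ y_le, of 2]; use J in simp)+
  define h where "h = (\<beta> - \<alpha>) / 4"
  have "4 * h = \<beta> - \<alpha>" by (simp add: h_def)
  then have h: "0 < h" "h \<le> 1/4" "\<beta> = \<alpha> + 4 * h" using J by linarith+
  have y_norm: "h ^ 5 \<le> L2_norm y"
  proof -
    \<comment> \<open>on the middle half of the interval \<open>\<phi> \<ge> h\<^sup>2\<close>, and \<open>|w| \<ge> 1/2\<close>\<close>
    have low: "indicator {\<alpha> + h..\<alpha> + 3 * h} x * (h ^ 8 / 4) \<le> indicator {0..} x * (cmod (y x))\<^sup>2" for x
    proof (cases "x \<in> {\<alpha> + h..\<alpha> + 3 * h}")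
      case True
      have "h * h \<le> (x - \<alpha>) * (\<beta> - x)" using True h by (intro mult_mono) auto
      then have "h * h \<le> cmod (\<phi> x)" by (simp add: \<phi>_def bump_def)
      then have "(h * h * (h * h)) * (1/2) \<le> cmod (y x)"
        unfolding y_def norm_mult using w(3)[of x] h by (intro mult_mono) auto
      then have *: "((h * h * (h * h)) * (1/2))\<^sup>2 \<le> (cmod (y x))\<^sup>2"
        using h by (intro power_mono) auto
      have **: "((h * h * (h * h)) * (1/2))\<^sup>2 = h ^ 8 / 4"
        by (simp add: power2_eq_square eval_nat_numeral)
      have "x \<in> {0..}" using True J h by auto
      with True * show ?thesis unfolding ** by simp
    qed simp
    have "h ^ 10 \<le> 2 * h * (h ^ 8 / 4)"
    proof -
      have "h ^ 10 = h * h ^ 9" by (simp add: eval_nat_numeral)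
      also have "\<dots> \<le> 1/4 * h ^ 9" using h by (intro mult_right_mono) auto
      also have "\<dots> \<le> 2 * h * (h ^ 8 / 4)" using h by (simp add: eval_nat_numeral)
      finally show ?thesis .
    qed
    also have "\<dots> = (LINT x|lebesgue. indicator {\<alpha> + h..\<alpha> + 3 * h} x * (h ^ 8 / 4))"
      using h by simp
    also have "\<dots> \<le> (LINT x|lebesgue. indicator {0..} x * (cmod (y x))\<^sup>2)"
    proof (rule integral_mono[OF _ _ low])
      have "integrable (lebesgue_on {0..}) (\<lambda>x. (cmod (y x))\<^sup>2)"
        using y_L2(1) by (simp add: square_integrable_def)
      then show "integrable lebesgue (\<lambda>x. indicator {0..} x * (cmod (y x))\<^sup>2)"
        by (subst (asm) integrable_restrict_space) (auto simp: set_integrable_def)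
      show "integrable lebesgue (\<lambda>x. indicator {\<alpha> + h..\<alpha> + 3 * h} x * (h ^ 8 / 4))"
        using h by (intro integrable_mult_left integrable_real_indicator) auto
    qed
    finally have "(h ^ 5)\<^sup>2 \<le> (LINT x|lebesgue. indicator {0..} x * (cmod (y x))\<^sup>2)"
      by (simp flip: power_mult)
    then show ?thesis unfolding L2_norm_eq by (rule real_le_rsqrt)
  qed
  have l_eq: "L2_eq g (l_expr s y u)"
    unfolding L2_eq_def using y' by (subst AE_restrict_space_iff) (auto elim: eventually_mono)
  have qd: "quasi_derivative s y u"
    unfolding quasi_derivative_def using y' AC_u
    by (auto simp: AE_restrict_space_iff elim: eventually_mono)
  have "bounded {x. 0 \<le> x \<and> y x \<noteq> 0}"
    by (rule bounded_subset[of "{\<alpha>..\<beta>}"]) (simp, use y_out in blast)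
  then have cpt: "compact (closure {x. 0 \<le> x \<and> y x \<noteq> 0})" by simp
  have "\<phi> 0 = 0" using \<phi>_out[of 0] J by auto
  then have "y 0 = 0" "u 0 = 0" by (auto simp: y_def u_def)
  moreover have "L2_eq y y" by (simp add: L2_eq_def)
  ultimately have "(y, g) \<in> minimal_operator s"
    unfolding minimal_operator_def
    using y_L2(1) g_L2(1) l_eq AC_y qd L2_cong[OF g_L2(1) l_eq] cpt by blast
  then show ?thesis using that y_out g_L2(2) y_L2(2) y_norm unfolding h_def by blast
qed

section \<open>Compact resolvents\<close>

text \<open>
  The inverse of \<open>L - z\<close> maps the bounded functions \<open>g\<^sub>n - z y\<^sub>n\<close> to \<open>y\<^sub>n\<close>, so by compactness some
  subsequence of \<open>y\<^sub>n\<close> converges. But any two of its terms differ, where the first is nonzero,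
  by that first function, whose norm is at least \<open>\<kappa>\<close>.
\<close>
lemma no_separated_bounded_sequence:
  fixes y g :: "nat \<Rightarrow> real \<Rightarrow> complex"
  assumes ext: "has_extension_with_compact_resolvent T"
    and T: "\<And>n. (y n, g n) \<in> T" "T \<subseteq> L2 \<times> L2"
    and bd: "\<And>n. L2_norm (g n) \<le> A" "\<And>n. L2_norm (y n) \<le> B"
    and low: "\<And>n. \<kappa> \<le> L2_norm (y n)" "0 < \<kappa>"
    and dis: "\<And>m n x. m < n \<Longrightarrow> y m x = 0 \<or> y n x = (0::complex)"
  shows False
proof -
  obtain L z where L: "T \<subseteq> L" and cpt: "compact_operator (resolvent L z)"
    using ext unfolding has_extension_with_compact_resolvent_def by blast
  have yL: "y n \<in> L2" and gL: "g n \<in> L2" for n using T(1)[of n] T(2) by auto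
  define F where "F = (\<lambda>n x. g n x - z * y n x)"
  have graph: "(F n, y n) \<in> resolvent L z" for n
    using T(1)[of n] L unfolding resolvent_def F_def by blast
  define C where "C = sqrt (2 * A\<^sup>2 + 2 * (cmod z * B)\<^sup>2)"
  have "L2_norm (F n) \<le> C" for n
  proof -
    have "(L2_norm (F n))\<^sup>2 \<le> 2 * (L2_norm (g n))\<^sup>2 + 2 * (cmod z * L2_norm (y n))\<^sup>2"
      using L2_diff(2)[OF gL L2_cmult[OF yL]] unfolding F_def L2_norm_cmult .
    also have "\<dots> \<le> 2 * A\<^sup>2 + 2 * (cmod z * B)\<^sup>2"
      using bd by (intro add_mono mult_left_mono power_mono mult_nonneg_nonneg L2_norm_nonneg) auto
    finally show ?thesis unfolding C_def by (rule real_le_rsqrt)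
  qed
  then have "\<exists>h\<in>L2. \<exists>r. strict_mono (r :: nat \<Rightarrow> nat) \<and>
           (\<lambda>n. L2_norm (\<lambda>x. y (r n) x - h x)) \<longlonglongrightarrow> 0"
    using cpt graph unfolding compact_operator_def by blast
  then obtain h r where h: "h \<in> L2" and r: "strict_mono (r :: nat \<Rightarrow> nat)"
    and lim: "(\<lambda>n. L2_norm (\<lambda>x. y (r n) x - h x)) \<longlonglongrightarrow> 0"
    by blast
  define e where "e = (\<lambda>n. L2_norm (\<lambda>x. y (r n) x - h x))"
  have le: "\<kappa>\<^sup>2 \<le> 2 * (e n)\<^sup>2 + 2 * (e (Suc n))\<^sup>2" for n
  proof -
    have "r n < r (Suc n)" using r by (simp add: strict_mono_Suc_iff)
    then have "L2_norm (y (r n)) \<le> L2_norm (\<lambda>x. y (r n) x - y (r (Suc n)) x)"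
      using dis by (intro L2_norm_le_diff_disjoint yL) blast
    moreover have "\<kappa> \<le> L2_norm (y (r n))" by (rule low(1))
    ultimately have "\<kappa>\<^sup>2 \<le> (L2_norm (\<lambda>x. y (r n) x - y (r (Suc n)) x))\<^sup>2"
      using low(2) by (intro power_mono) auto
    also have "(\<lambda>x. y (r n) x - y (r (Suc n)) x) = (\<lambda>x. (y (r n) x - h x) - (y (r (Suc n)) x - h x))"
      by simp
    also have "(L2_norm \<dots>)\<^sup>2 \<le> 2 * (e n)\<^sup>2 + 2 * (e (Suc n))\<^sup>2"
      unfolding e_def by (intro L2_diff(2) L2_diff(1)[OF yL h])
    finally show ?thesis .
  qed
  have "e \<longlonglongrightarrow> 0" using lim unfolding e_def .
  then have "(\<lambda>n. 2 * (e n)\<^sup>2 + 2 * (e (Suc n))\<^sup>2) \<longlonglongrightarrow> 2 * 0\<^sup>2 + 2 * 0\<^sup>2"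
    by (intro tendsto_intros LIMSEQ_Suc)
  then have "\<kappa>\<^sup>2 \<le> 2 * 0\<^sup>2 + 2 * 0\<^sup>2"
    by (rule LIMSEQ_le_const) (use le in blast)
  then show False using low(2) by simp
qed

section \<open>Intervals of bounded oscillation\<close>

lemma exists_subinterval_small_integral:
  fixes f :: "real \<Rightarrow> real" and N :: nat and \<epsilon> :: real
  assumes f: "f integrable_on {x..x + a}" and "0 < a" "0 < N"
    and le: "integral {x..x + a} f \<le> N * \<epsilon>"
  obtains k where "k < N" "integral {x + real k * (a / N)..x + real k * (a / N) + a / N} f \<le> \<epsilon>"
proof -
  define h where "h = a / N"
  have h: "h > 0" "N * h = a" using assms by (auto simp: h_def)
  have sum: "(\<Sum>k<n. integral {x + real k * h..x + real k * h + h} f) = integral {x..x + n * h} f" if "n \<le> N" for n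
    using that
  proof (induction n)
    case (Suc n)
    have "real (Suc n) * h \<le> N * h" using Suc.prems h by (intro mult_right_mono) auto
    then have le: "x + real (Suc n) * h \<le> x + a" using h by simp
    have eq: "x + real (Suc n) * h = x + n * h + h" by (simp add: algebra_simps)
    have "integral {x..x + n * h} f + integral {x + n * h..x + n * h + h} f = integral {x..x + n * h + h} f"
    proof (rule Henstock_Kurzweil_Integration.integral_combine)
      show "f integrable_on {x..x + n * h + h}"
        by (rule integrable_on_subinterval[OF f]) (use le eq in auto)
    qed (use h in auto)
    then show ?case using Suc by (simp add: eq del: of_nat_Suc)
  qed simp
  have "\<exists>k<N. integral {x + real k * h..x + real k * h + h} f \<le> \<epsilon>"
  proof (rule ccontr)
    assume "\<not> ?thesis"
    then have "(\<Sum>k<N. \<epsilon>) < (\<Sum>k<N. integral {x + real k * h..x + real k * h + h} f)"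
      using \<open>0 < N\<close> by (intro sum_strict_mono) auto
    then show False using le sum[of N] h by simp
  qed
  then show ?thesis using that unfolding h_def by blast
qed

text \<open>
  If the integral of \<open>|f - f(\<eta>)|\<^sup>2\<close> exceeded \<open>K\<close> divided by the total mass for every \<open>\<eta>\<close>, then its
  integral over \<open>\<eta>\<close> would be at least \<open>K\<close>. Expanding the square shows that the inner integral is
  an integrable function of \<open>\<eta>\<close>, so that the outer integral is not a default value.
\<close>
lemma (in finite_measure) exists_value_mean_square_le:
  fixes f :: "'a \<Rightarrow> complex"
  assumes f[measurable]: "f \<in> borel_measurable M" and f2: "integrable M (\<lambda>x. (cmod (f x))\<^sup>2)"
    and pos: "0 < measure M (space M)"
    and le: "(LINT \<eta>|M. LINT \<xi>|M. (cmod (f \<xi> - f \<eta>))\<^sup>2) < K"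
  obtains c where "integrable M (\<lambda>x. (cmod (f x - c))\<^sup>2)"
    "(LINT x|M. (cmod (f x - c))\<^sup>2) \<le> K / measure M (space M)"
proof -
  have fi: "integrable M f"
  proof (rule Bochner_Integration.integrable_bound)
    show "integrable M (\<lambda>x. (cmod (f x))\<^sup>2 + 1)" using f2 by simp
    have "cmod w \<le> (cmod w)\<^sup>2 + 1" for w
      using sum_squares_bound[of "cmod w" 1] norm_ge_zero[of w] by (simp del: norm_ge_zero)
    then show "AE x in M. norm (f x) \<le> norm ((cmod (f x))\<^sup>2 + 1)" by (intro AE_I2) simp
  qed simp
  have re: "integrable M (\<lambda>x. Re (f x))" and im: "integrable M (\<lambda>x. Im (f x))" using fi by auto
  have expand: "(cmod (f \<xi> - c))\<^sup>2 = (cmod (f \<xi>))\<^sup>2 + (cmod c)\<^sup>2 - 2 * (Re (f \<xi>) * Re c + Im (f \<xi>) * Im c)"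
    for \<xi> c unfolding cmod_power2 by (simp add: power2_eq_square algebra_simps)
  have int: "integrable M (\<lambda>\<xi>. (cmod (f \<xi> - c))\<^sup>2)" for c
    unfolding expand using f2 re im by auto
  have inner: "(LINT \<xi>|M. (cmod (f \<xi> - c))\<^sup>2) = (LINT \<xi>|M. (cmod (f \<xi>))\<^sup>2) + (cmod c)\<^sup>2 * measure M (space M)
      - 2 * ((LINT \<xi>|M. Re (f \<xi>)) * Re c + (LINT \<xi>|M. Im (f \<xi>)) * Im c)" for c
    unfolding expand using f2 re im by simp
  define I where "I = (\<lambda>\<eta>. LINT \<xi>|M. (cmod (f \<xi> - f \<eta>))\<^sup>2)"
  have Ii: "integrable M I" unfolding I_def inner using f2 re im by auto
  have "\<exists>\<eta>\<in>space M. I \<eta> \<le> K / measure M (space M)"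
  proof (rule ccontr)
    assume "\<not> ?thesis"
    then have "K / measure M (space M) \<le> I \<eta>" if "\<eta> \<in> space M" for \<eta> using that by force
    then have "(LINT \<eta>|M. K / measure M (space M)) \<le> (LINT \<eta>|M. I \<eta>)"
      by (intro integral_mono Ii) auto
    then show False using pos le by (simp add: I_def)
  qed
  then show ?thesis using that int unfolding I_def by blast
qed

text \<open>
  What matters is that the bounds on \<open>y\<close> and \<open>g\<close> do not depend on \<open>x\<close>: \<open>K\<close> controls the norm of
  \<open>s - c\<close> for a suitable \<open>c\<close>, whatever the size of \<open>s\<close> itself, and the subinterval that carries
  \<open>y\<close> has the length \<open>a / N\<close> wherever it lies.
\<close>
lemma test_function_of_bounded_oscillation:
  fixes s :: "real \<Rightarrow> complex"
  assumes s: "s \<in> square_integrable_loc" and x: "0 \<le> x" and a: "0 < a"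
    and N: "0 < N" "a \<le> real N" "K / a + a \<le> real N / 8"
    and le: "(LINT \<eta>:{x..x+a}|lebesgue. (LINT \<xi>:{x..x+a}|lebesgue. (cmod (s \<xi> - s \<eta>))\<^sup>2)) < K"
  obtains y g where "(y, g) \<in> minimal_operator s" "\<And>t. t \<notin> {x..x+a} \<Longrightarrow> y t = 0"
    "L2_norm g \<le> 10" "L2_norm y \<le> 2" "(a / N / 4) ^ 5 \<le> L2_norm y"
proof -
  let ?I = "{x..x+a}"
  interpret I: finite_measure "lebesgue_on ?I"
    by (rule finite_measure_lebesgue_on) simp
  have mI: "measure (lebesgue_on ?I) (space (lebesgue_on ?I)) = a"
    using a by (simp add: measure_restrict_space)
  have s_R: "s \<in> square_integrable {0..x+a}" using s x a by (auto simp: square_integrable_loc_def)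
  have sub: "?I \<subseteq> {0..x+a}" using x by auto
  have s_meas: "s \<in> borel_measurable (lebesgue_on ?I)"
    using s_R unfolding square_integrable_def by (auto intro: measurable_restrict_mono[OF _ sub])
  have s_int: "integrable (lebesgue_on ?I) (\<lambda>x. (cmod (s x))\<^sup>2)"
  proof -
    have "set_integrable lebesgue {0..x+a} (\<lambda>x. (cmod (s x))\<^sup>2)"
      using s_R unfolding square_integrable_def by (auto simp: integrable_restrict_space set_integrable_def)
    then have "set_integrable lebesgue ?I (\<lambda>x. (cmod (s x))\<^sup>2)"
      by (rule set_integrable_subset) (use sub in auto)
    then show ?thesis by (auto simp: integrable_restrict_space set_integrable_def)
  qed
  have LINT: "(LINT t|lebesgue_on ?I. f t) = (LINT t:?I|lebesgue. f t)" for f :: "real \<Rightarrow> real"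
    unfolding set_lebesgue_integral_def by (subst integral_restrict_space) auto
  obtain c where c: "integrable (lebesgue_on ?I) (\<lambda>t. (cmod (s t - c))\<^sup>2)"
    "(LINT t|lebesgue_on ?I. (cmod (s t - c))\<^sup>2) \<le> K / a"
    using I.exists_value_mean_square_le[OF s_meas s_int, of K] le a unfolding mI LINT by blast
  define f where "f = (\<lambda>t. (cmod (s t - c))\<^sup>2 + 1)"
  have "integrable (lebesgue_on ?I) f" unfolding f_def using c(1) by simp
  then have f_set: "set_integrable lebesgue ?I f"
    by (auto simp: integrable_restrict_space set_integrable_def)
  have f_le: "integral ?I f \<le> N * (1/8)"
  proof -
    have "integral ?I f = (LINT t|lebesgue_on ?I. f t)"
      unfolding LINT by (rule set_lebesgue_integral_eq_integral(2)[OF f_set, symmetric])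
    also have "\<dots> = (LINT t|lebesgue_on ?I. (cmod (s t - c))\<^sup>2) + a"
      unfolding f_def using c(1) mI by simp
    also have "\<dots> \<le> K / a + a" using c(2) by simp
    also have "\<dots> \<le> N * (1/8)" using N(3) by simp
    finally show ?thesis .
  qed
  obtain k where k: "k < N" "integral {x + real k * (a / N)..x + real k * (a / N) + a / N} f \<le> 1/8"
    using exists_subinterval_small_integral[OF set_lebesgue_integral_eq_integral(1)[OF f_set] a N(1) f_le] .
  define \<alpha> where "\<alpha> = x + real k * (a / N)"
  define \<beta> where "\<beta> = \<alpha> + a / N"
  have "real k * (a / N) + a / N = real (Suc k) * (a / N)" by (simp add: algebra_simps add_divide_distrib)
  also have "\<dots> \<le> N * (a / N)" using k a by (intro mult_right_mono) auto
  also have "\<dots> = a" using N by simp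
  finally have \<beta>_le: "\<beta> \<le> x + a" by (simp add: \<alpha>_def \<beta>_def)
  have \<alpha>: "0 \<le> \<alpha>" "x \<le> \<alpha>" using x a by (auto simp: \<alpha>_def)
  have \<beta>: "\<alpha> < \<beta>" "\<beta> \<le> \<alpha> + 1" using a N by (auto simp: \<beta>_def)
  have fJ: "set_integrable lebesgue {\<alpha>..\<beta>} f"
    by (rule set_integrable_subset[OF f_set]) (use \<alpha> \<beta>_le in auto)
  have "(LINT t|lebesgue. indicator {\<alpha>..\<beta>} t * f t) = integral {\<alpha>..\<beta>} f"
    using set_lebesgue_integral_eq_integral(2)[OF fJ] by (simp add: set_lebesgue_integral_def)
  also have "\<dots> \<le> 1/8" using k(2) by (simp add: \<alpha>_def \<beta>_def)
  finally have small: "(LINT t|lebesgue. indicator {\<alpha>..\<beta>} t * ((cmod (s t - c))\<^sup>2 + 1)) \<le> 1/8"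
    unfolding f_def .
  have int: "integrable lebesgue (\<lambda>t. indicator {\<alpha>..\<beta>} t * ((cmod (s t - c))\<^sup>2 + 1))"
    using fJ by (simp add: set_integrable_def f_def)
  obtain y g where y: "(y, g) \<in> minimal_operator s" "\<And>t. t \<notin> {\<alpha>..\<beta>} \<Longrightarrow> y t = 0"
    "L2_norm g \<le> 10" "L2_norm y \<le> 2" "((\<beta> - \<alpha>) / 4) ^ 5 \<le> L2_norm y"
    by (rule test_function_on_short_interval[OF \<alpha>(1) \<beta> s int small]) blast
  show ?thesis
  proof (rule that[OF y(1) _ y(3,4)])
    show "y t = 0" if "t \<notin> {x..x+a}" for t
      using that \<alpha> \<beta>_le by (intro y(2)) auto
    show "(a / N / 4) ^ 5 \<le> L2_norm y" using y(5) by (simp add: \<beta>_def)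
  qed
qed

theorem theorem1:
  fixes s :: "real \<Rightarrow> complex"
  assumes "s \<in> square_integrable_loc"
    and "has_extension_with_compact_resolvent (minimal_operator s)"
  shows "\<forall>a>0. filterlim
    (\<lambda>x::real. LINT \<eta>:{x..x+a}|lebesgue. (LINT \<xi>:{x..x+a}|lebesgue. (cmod (s \<xi> - s \<eta>))\<^sup>2))
    at_top at_top"
proof (intro allI impI, rule ccontr)
  fix a :: real assume a: "a > 0"
  define D where "D = (\<lambda>x::real. LINT \<eta>:{x..x+a}|lebesgue. (LINT \<xi>:{x..x+a}|lebesgue. (cmod (s \<xi> - s \<eta>))\<^sup>2))"
  assume "\<not> filterlim (\<lambda>x::real. LINT \<eta>:{x..x+a}|lebesgue. (LINT \<xi>:{x..x+a}|lebesgue. (cmod (s \<xi> - s \<eta>))\<^sup>2))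
    at_top at_top"
  then have "\<not> filterlim D at_top at_top" unfolding D_def .
  then obtain K where K: "\<And>X. \<exists>x\<ge>X. D x < K"
    unfolding filterlim_at_top eventually_at_top_linorder by (meson not_le)
  \<comment> \<open>\<open>N\<close> subintervals: enough that one has integral at most 1/8 and all have length at most 1\<close>
  obtain N :: nat where N: "max (max 1 a) ((K / a + a) * 8) \<le> real N" using real_arch_simple by blast
  then have N1: "1 \<le> real N" "a \<le> real N" "(K / a + a) * 8 \<le> real N"
    unfolding max.bounded_iff by blast+
  have N': "0 < N" "K / a + a \<le> real N / 8"
    using N1(1) by (simp, subst pos_le_divide_eq) (simp, rule N1(3))
  define \<kappa> where "\<kappa> = (a / N / 4) ^ 5"
  have "\<kappa> > 0" using a N' by (simp add: \<kappa>_def)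
  define good where "good = (\<lambda>(x, y, g). 0 \<le> x \<and> (y, g) \<in> minimal_operator s \<and> (\<forall>t. t \<notin> {x..x+a} \<longrightarrow> y t = 0) \<and>
    L2_norm g \<le> 10 \<and> L2_norm y \<le> 2 \<and> \<kappa> \<le> L2_norm y)"
  have ex: "\<exists>p. good p \<and> X \<le> fst p" for X
  proof -
    obtain x where x: "x \<ge> max 0 X" "D x < K" using K by blast
    have "0 \<le> x" using x by simp
    obtain y g where "(y, g) \<in> minimal_operator s" "\<And>t. t \<notin> {x..x+a} \<Longrightarrow> y t = 0"
      "L2_norm g \<le> 10" "L2_norm y \<le> 2" "\<kappa> \<le> L2_norm y"
      unfolding \<kappa>_def
      by (rule test_function_of_bounded_oscillation[OF assms(1) \<open>0 \<le> x\<close> a N'(1) N1(2) N'(2) x(2)[unfolded D_def]]) blast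
    then have "good (x, y, g)" using \<open>0 \<le> x\<close> by (simp add: good_def)
    then show ?thesis using x by (intro exI[of _ "(x, y, g)"]) simp
  qed
  \<comment> \<open>consecutive left end points more than \<open>a\<close> apart make the intervals disjoint\<close>
  have "\<exists>p. \<forall>n. good (p n) \<and> fst (p n) + a + 1 \<le> fst (p (Suc n))"
    by (rule dependent_nat_choice) (use ex in blast)+
  then obtain p where p: "\<And>n. good (p n)" "\<And>n. fst (p n) + a + 1 \<le> fst (p (Suc n))" by blast
  define y where "y = (\<lambda>n. fst (snd (p n)))"
  define g where "g = (\<lambda>n. snd (snd (p n)))"
  have yg: "(y n, g n) \<in> minimal_operator s" "\<And>t. t \<notin> {fst (p n)..fst (p n) + a} \<Longrightarrow> y n t = 0"
    "L2_norm (g n) \<le> 10" "L2_norm (y n) \<le> 2" "\<kappa> \<le> L2_norm (y n)" for n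
    using p(1)[of n] by (auto simp: good_def y_def g_def split: prod.splits)
  have mono: "fst (p m) \<le> fst (p n)" if "m \<le> n" for m n
    using that by (rule lift_Suc_mono_le[rotated]) (use p(2) a in \<open>smt (verit)\<close>)
  have dis: "y m t = 0 \<or> y n t = 0" if "m < n" for m n t
  proof -
    have "fst (p m) + a + 1 \<le> fst (p n)"
      using p(2)[of m] mono[of "Suc m" n] that by linarith
    then show ?thesis using yg(2)[of t m] yg(2)[of t n] by force
  qed
  show False
    by (rule no_separated_bounded_sequence[OF assms(2) yg(1) _ yg(3,4,5) \<open>\<kappa> > 0\<close> dis])
      (auto simp: minimal_operator_def)
qed

end
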